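(* Let $\mathcal{K}$ be a Kreĭn space and $G$ a group of unitary operators on $\mathcal{K}$ whose representation on $\mathcal{K}$ is fundamental. Then the following three notions coincide (i.e. are equivalent for $\mathcal{K}$ under $G$): 1. regular irreducibility; 2. operator irreducibility; 3. topological irreducibility.
   Context: A Kreĭn space is a complex vector space $\mathcal{K}$ with a Hermitian sesquilinear form $[\cdot,\cdot]$ admitting a fundamental symmetry $J$ ($J^2=I$, $\langle x,y\rangle=[Jx,y]$ a Hilbert inner product); its topology is that of any such Hilbert norm. Unitarity, adjoints $A^{[*]}$ and positivity ($[Ax,x]\ge0$) are with respect to $[\cdot,\cdot]$. The representation is fundamental if there is $g\in G$ with $g=g^{[*]}=g^{-1}$ and $g$ positive. A subspace is regular if it is closed and a Kreĭn space for the restricted form. Regular irreducibility: no invariant regular subspace other than $0$ and $\mathcal{K}$. Topological irreducibility: no invariant closed subspace other than $0$ and $\mathcal{K}$. Operator irreducibility: every bounded operator on $\mathcal{K}$ commuting with all elements of $G$ is a scalar multiple of the identity. *)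

theory Defs
  imports "HOL-Analysis.Analysis" "HOL-Algebra.Bij"
begin

text \<open>
  The distribution has no type class of complex vector spaces, so a complex vector space is an
  additive group \<open>'a\<close> with an explicit scalar multiplication satisfying the library locale
  \<open>vector_space\<close>.  Notions needed both for the whole space and for its subspaces are relative
  to a carrier \<open>S\<close>; the whole space is \<open>S = UNIV\<close>.  Sesquilinear forms are linear in the first
  argument.
\<close>

type_synonym 'a scaling = "complex \<Rightarrow> 'a \<Rightarrow> 'a"
type_synonym 'a form = "'a \<Rightarrow> 'a \<Rightarrow> complex"

definition hermitian_form_on :: "'a::ab_group_add scaling \<Rightarrow> 'a form \<Rightarrow> 'a set \<Rightarrow> bool" where
  "hermitian_form_on smul form S \<longleftrightarrow>
     (\<forall>x\<in>S. \<forall>y\<in>S. \<forall>z\<in>S. form (x + y) z = form x z + form y z) \<and>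
     (\<forall>c. \<forall>x\<in>S. \<forall>y\<in>S. form (smul c x) y = c * form x y) \<and>
     (\<forall>x\<in>S. \<forall>y\<in>S. form y x = cnj (form x y))"

definition ip_norm :: "'a form \<Rightarrow> 'a \<Rightarrow> real" where
  "ip_norm ip x = sqrt (Re (ip x x))"

definition ip_dist :: "'a::ab_group_add form \<Rightarrow> 'a \<Rightarrow> 'a \<Rightarrow> real" where
  "ip_dist ip x y = ip_norm ip (x - y)"

definition hilbert_inner_on :: "'a::ab_group_add scaling \<Rightarrow> 'a form \<Rightarrow> 'a set \<Rightarrow> bool" where
  "hilbert_inner_on smul ip S \<longleftrightarrow>
     hermitian_form_on smul ip S \<and>
     (\<forall>x\<in>S. x \<noteq> 0 \<longrightarrow> Re (ip x x) > 0) \<and>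
     (\<forall>\<sigma>::nat \<Rightarrow> 'a. range \<sigma> \<subseteq> S \<and>
          (\<forall>e>0. \<exists>N. \<forall>m\<ge>N. \<forall>n\<ge>N. ip_dist ip (\<sigma> m) (\<sigma> n) < e) \<longrightarrow>
          (\<exists>x\<in>S. (\<lambda>n. ip_dist ip (\<sigma> n) x) \<longlonglongrightarrow> 0))"

definition fundamental_symmetry_on ::
    "'a::ab_group_add scaling \<Rightarrow> 'a form \<Rightarrow> 'a set \<Rightarrow> ('a \<Rightarrow> 'a) \<Rightarrow> bool" where
  "fundamental_symmetry_on smul form S J \<longleftrightarrow>
     J ` S \<subseteq> S \<and>
     (\<forall>x\<in>S. \<forall>y\<in>S. J (x + y) = J x + J y) \<and>
     (\<forall>c. \<forall>x\<in>S. J (smul c x) = smul c (J x)) \<and>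
     (\<forall>x\<in>S. J (J x) = x) \<and>
     hilbert_inner_on smul (\<lambda>x y. form (J x) y) S"

definition krein_space_on :: "'a::ab_group_add scaling \<Rightarrow> 'a form \<Rightarrow> 'a set \<Rightarrow> bool" where
  "krein_space_on smul form S \<longleftrightarrow>
     vector_space smul \<and> module.subspace smul S \<and>
     hermitian_form_on smul form S \<and>
     (\<exists>J. fundamental_symmetry_on smul form S J)"

abbreviation krein_space :: "'a::ab_group_add scaling \<Rightarrow> 'a form \<Rightarrow> bool" where
  "krein_space smul form \<equiv> krein_space_on smul form UNIV"

text \<open>
  Any two fundamental symmetries of a Krein space induce equivalent Hilbert norms, so the choice
  made here affects neither which subspaces are closed nor which operators are bounded.
\<close>

definition krein_inner :: "'a::ab_group_add scaling \<Rightarrow> 'a form \<Rightarrow> 'a form" where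
  "krein_inner smul form =
     (let J = SOME J. fundamental_symmetry_on smul form UNIV J in (\<lambda>x y. form (J x) y))"

definition krein_norm :: "'a::ab_group_add scaling \<Rightarrow> 'a form \<Rightarrow> 'a \<Rightarrow> real" where
  "krein_norm smul form = ip_norm (krein_inner smul form)"

definition krein_topology :: "'a::ab_group_add scaling \<Rightarrow> 'a form \<Rightarrow> 'a topology" where
  "krein_topology smul form = Metric_space.mtopology UNIV (ip_dist (krein_inner smul form))"

definition closed_subspace :: "'a::ab_group_add scaling \<Rightarrow> 'a form \<Rightarrow> 'a set \<Rightarrow> bool" where
  "closed_subspace smul form S \<longleftrightarrow>
     module.subspace smul S \<and> closedin (krein_topology smul form) S"

definition regular_subspace :: "'a::ab_group_add scaling \<Rightarrow> 'a form \<Rightarrow> 'a set \<Rightarrow> bool" where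
  "regular_subspace smul form S \<longleftrightarrow>
     closed_subspace smul form S \<and> krein_space_on smul form S"

definition bounded_operator :: "'a::ab_group_add scaling \<Rightarrow> 'a form \<Rightarrow> ('a \<Rightarrow> 'a) \<Rightarrow> bool" where
  "bounded_operator smul form A \<longleftrightarrow>
     Vector_Spaces.linear smul smul A \<and>
     (\<exists>C. \<forall>x. krein_norm smul form (A x) \<le> C * krein_norm smul form x)"

text \<open>\<open>krein_adjoint form A B\<close> says that \<open>B\<close> is the adjoint of \<open>A\<close> with respect to the form
  (which is unique, the form being nondegenerate).\<close>

definition krein_adjoint :: "'a form \<Rightarrow> ('a \<Rightarrow> 'a) \<Rightarrow> ('a \<Rightarrow> 'a) \<Rightarrow> bool" where
  "krein_adjoint form A B \<longleftrightarrow> (\<forall>x y. form (A x) y = form x (B y))"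

text \<open>The adjoint of a unitary operator is its inverse.  Boundedness is not required, since a
  linear bijection preserving the form is automatically bounded.\<close>

definition krein_unitary :: "'a::ab_group_add scaling \<Rightarrow> 'a form \<Rightarrow> ('a \<Rightarrow> 'a) \<Rightarrow> bool" where
  "krein_unitary smul form U \<longleftrightarrow>
     Vector_Spaces.linear smul smul U \<and> bij U \<and> krein_adjoint form U (inv_into UNIV U)"

definition krein_positive :: "'a form \<Rightarrow> ('a \<Rightarrow> 'a) \<Rightarrow> bool" where
  "krein_positive form A \<longleftrightarrow> (\<forall>x. form (A x) x \<in> \<real>\<^sub>\<ge>\<^sub>0)"

definition unitary_operator_group ::
    "'a::ab_group_add scaling \<Rightarrow> 'a form \<Rightarrow> ('a \<Rightarrow> 'a) set \<Rightarrow> bool" where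
  "unitary_operator_group smul form G \<longleftrightarrow>
     subgroup G (BijGroup UNIV) \<and> (\<forall>g\<in>G. krein_unitary smul form g)"

definition fundamental_representation :: "'a form \<Rightarrow> ('a \<Rightarrow> 'a) set \<Rightarrow> bool" where
  "fundamental_representation form G \<longleftrightarrow>
     (\<exists>g\<in>G. krein_adjoint form g g \<and> g = inv_into UNIV g \<and> krein_positive form g)"

definition invariant_under :: "('a \<Rightarrow> 'a) set \<Rightarrow> 'a set \<Rightarrow> bool" where
  "invariant_under G S \<longleftrightarrow> (\<forall>g\<in>G. g ` S \<subseteq> S)"

definition regularly_irreducible ::
    "'a::ab_group_add scaling \<Rightarrow> 'a form \<Rightarrow> ('a \<Rightarrow> 'a) set \<Rightarrow> bool" where
  "regularly_irreducible smul form G \<longleftrightarrow>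
     (\<forall>S. regular_subspace smul form S \<and> invariant_under G S \<longrightarrow> S = {0} \<or> S = UNIV)"

definition topologically_irreducible ::
    "'a::ab_group_add scaling \<Rightarrow> 'a form \<Rightarrow> ('a \<Rightarrow> 'a) set \<Rightarrow> bool" where
  "topologically_irreducible smul form G \<longleftrightarrow>
     (\<forall>S. closed_subspace smul form S \<and> invariant_under G S \<longrightarrow> S = {0} \<or> S = UNIV)"

definition operator_irreducible ::
    "'a::ab_group_add scaling \<Rightarrow> 'a form \<Rightarrow> ('a \<Rightarrow> 'a) set \<Rightarrow> bool" where
  "operator_irreducible smul form G \<longleftrightarrow>
     (\<forall>A. bounded_operator smul form A \<and> (\<forall>g\<in>G. A \<circ> g = g \<circ> A) \<longrightarrow> (\<exists>c. A = smul c))"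

end

theory Submission
  imports Defs
begin

text \<open>
  Let \<open>g\<close> be the positive selfadjoint involution in \<open>G\<close>.  Then \<open>\<langle>x, y\<rangle> = [g x, y]\<close> is a Hilbert inner
  product inducing the Krein topology, and \<open>G\<close> is closed under its adjoint, since \<open>h\<^sup>* = g h\<^sup>-\<^sup>1 g\<close>.  An
  invariant closed subspace is invariant under \<open>g\<close>, which restricts to a fundamental symmetry, so it is
  regular.  Operator and topological irreducibility are equivalent by Schur's lemma: an orthogonal
  projection onto an invariant closed subspace commutes with \<open>G\<close>; conversely, if \<open>B\<close> is selfadjoint and
  commutes with \<open>G\<close>, then \<open>ker (\<bar>B\<bar> - B)\<close> is invariant, hence \<open>B\<close> is semidefinite.  Applied to
  \<open>B = A - \<lambda>\<close> for all real \<open>\<lambda>\<close>, this makes \<open>A\<close> scalar, so no spectral theorem is needed.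
\<close>

subsection \<open>Hermitian forms and Hilbert spaces\<close>

locale hermitian_form = vector_space smul
  for smul :: "complex \<Rightarrow> 'a::ab_group_add \<Rightarrow> 'a" +
  fixes ip :: "'a \<Rightarrow> 'a \<Rightarrow> complex"
  assumes hermitian: "hermitian_form_on smul ip UNIV"
begin

lemma ip_commute: "ip y x = cnj (ip x y)"
  and ip_add_left: "ip (x + y) z = ip x z + ip y z"
  and ip_scale_left: "ip (smul c x) y = c * ip x y"
  using hermitian unfolding hermitian_form_on_def by blast+

lemma ip_add_right: "ip x (y + z) = ip x y + ip x z"
  by (metis ip_commute ip_add_left complex_cnj_add)

lemma ip_scale_right: "ip x (smul c y) = cnj c * ip x y"
  by (metis ip_commute ip_scale_left complex_cnj_mult)

lemma ip_zero_left [simp]: "ip 0 x = 0"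
  using ip_add_left[of 0 0 x] by simp

lemma ip_zero_right [simp]: "ip x 0 = 0"
  using ip_add_right[of x 0 0] by simp

lemma ip_minus_left: "ip (- x) y = - ip x y"
  using ip_add_left[of x "- x" y] by (simp add: eq_neg_iff_add_eq_0 add.commute)

lemma ip_minus_right: "ip x (- y) = - ip x y"
  using ip_add_right[of x y "- y"] by (simp add: eq_neg_iff_add_eq_0 add.commute)

lemma ip_diff_left: "ip (x - y) z = ip x z - ip y z"
  using ip_add_left[of x "- y" z] by (simp add: ip_minus_left)

lemma ip_diff_right: "ip x (y - z) = ip x y - ip x z"
  using ip_add_right[of x y "- z"] by (simp add: ip_minus_right)

lemmas ip_simps = ip_add_left ip_add_right ip_diff_left ip_diff_right ip_scale_left ip_scale_right
  ip_minus_left ip_minus_right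

lemma Im_ip_self [simp]: "Im (ip x x) = 0"
  using ip_commute[of x x] by (metis cnj.simps(2) equal_neg_zero)

lemma ip_self: "ip x x = of_real (Re (ip x x))"
  by (simp add: complex_eq_iff)

lemma Re_ip_commute: "Re (ip y x) = Re (ip x y)"
  by (metis ip_commute cnj.simps(1))

text \<open>Nonnegativity at \<open>x - t (x,y) y\<close> for all real \<open>t\<close> gives the
  bound. Stated for semidefinite forms because it is later applied to the form of \<open>g\<close>
  before definiteness of that form is known.\<close>

lemma Cauchy_Schwarz_semidefinite:
  assumes "\<And>z. Re (ip z z) \<ge> 0"
  shows "(cmod (ip x y))\<^sup>2 \<le> Re (ip x x) * Re (ip y y)"
proof (cases "ip x y = 0")
  case True
  then show ?thesis using assms by simp
next
  case False
  define m where "m = (cmod (ip x y))\<^sup>2"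
  define a where "a = Re (ip x x)"
  define b where "b = Re (ip y y)"
  have m: "m > 0" using False by (simp add: m_def)
  have b: "b \<ge> 0" using assms by (simp add: b_def)
  have mult: "ip x y * cnj (ip x y) = of_real m"
    by (simp add: m_def complex_norm_square[symmetric])
  have *: "0 \<le> a - 2 * t * m + t\<^sup>2 * m * b" for t :: real
  proof -
    let ?c = "of_real t * ip x y"
    have yx: "ip y x = cnj (ip x y)" by (rule ip_commute)
    have "ip (x - smul ?c y) (x - smul ?c y)
        = ip x x - 2 * of_real t * (ip x y * cnj (ip x y))
          + (of_real t)\<^sup>2 * (ip x y * cnj (ip x y)) * ip y y"
      unfolding ip_simps complex_cnj_mult complex_cnj_complex_of_real yx
      by (simp add: field_simps power2_eq_square)
    also have "\<dots> = of_real (a - 2 * t * m + t\<^sup>2 * m * b)"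
      unfolding mult by (subst ip_self[of x], subst ip_self[of y]) (simp add: a_def b_def)
    finally show ?thesis using assms[of "x - smul ?c y"] by simp
  qed
  \<comment> \<open>For \<open>b = 0\<close> the bound is affine in \<open>t\<close> with slope
    \<open>- 2 * m\<close>; the chosen \<open>t\<close> gives the value \<open>-1\<close>.\<close>
  have "b \<noteq> 0"
  proof
    assume "b = 0"
    then show False using *[of "(a + 1) / (2 * m)"] m by (simp add: field_simps)
  qed
  then have "b > 0" using b by simp
  \<comment> \<open>The quadratic in \<open>t\<close> is smallest at
    \<open>t = 1 / b\<close>.\<close>
  then have "0 \<le> a - m / b"
    using *[of "1 / b"] by (simp add: field_simps power2_eq_square)
  then show ?thesis using \<open>b > 0\<close> by (simp add: m_def a_def b_def field_simps)
qed

end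

locale complex_hilbert = vector_space smul
  for smul :: "complex \<Rightarrow> 'a::ab_group_add \<Rightarrow> 'a" +
  fixes ip :: "'a \<Rightarrow> 'a \<Rightarrow> complex"
  assumes hilbert: "hilbert_inner_on smul ip UNIV"
begin

sublocale hermitian_form smul ip
  using hilbert by unfold_locales (simp add: hilbert_inner_on_def)

abbreviation N :: "'a \<Rightarrow> real" where "N \<equiv> ip_norm ip"

lemma ip_pos: "x \<noteq> 0 \<Longrightarrow> Re (ip x x) > 0"
  using hilbert unfolding hilbert_inner_on_def by blast

lemma ip_nonneg: "Re (ip x x) \<ge> 0"
  using ip_pos[of x] by (cases "x = 0") auto

lemma N_sq: "(N x)\<^sup>2 = Re (ip x x)"
  using ip_nonneg by (simp add: ip_norm_def)

lemma ip_N: "ip x x = of_real ((N x)\<^sup>2)"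
  using N_sq ip_self by simp

lemma N_nonneg [simp]: "N x \<ge> 0"
  using ip_nonneg by (simp add: ip_norm_def)

lemma N_eq_0 [simp]: "N x = 0 \<longleftrightarrow> x = 0"
  unfolding ip_norm_def using ip_pos[of x] by (cases "x = 0") simp_all

lemma N_zero [simp]: "N 0 = 0"
  by (simp add: ip_norm_def)

lemma Cauchy_Schwarz: "cmod (ip x y) \<le> N x * N y"
proof -
  have "(cmod (ip x y))\<^sup>2 \<le> (N x * N y)\<^sup>2"
    using Cauchy_Schwarz_semidefinite[OF ip_nonneg] by (simp add: power_mult_distrib N_sq)
  then show ?thesis by (simp add: power2_le_iff_abs_le)
qed

lemma Re_ip_le: "\<bar>Re (ip x y)\<bar> \<le> N x * N y"
  using Cauchy_Schwarz abs_Re_le_cmod order_trans by blast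

lemma N_minus: "N (- x) = N x"
  by (simp add: ip_norm_def ip_simps)

lemma N_minus_commute: "N (x - y) = N (y - x)"
  by (metis N_minus minus_diff_eq)

lemma N_scale: "N (smul c x) = cmod c * N x"
proof -
  have "ip (smul c x) (smul c x) = (c * cnj c) * ip x x" by (simp add: ip_simps)
  then have "Re (ip (smul c x) (smul c x)) = (cmod c)\<^sup>2 * Re (ip x x)"
    by (simp add: complex_norm_square[symmetric] flip: of_real_power)
  then show ?thesis by (simp add: ip_norm_def real_sqrt_mult)
qed

lemma N_add_sq: "(N (x + y))\<^sup>2 = (N x)\<^sup>2 + 2 * Re (ip x y) + (N y)\<^sup>2"
  by (simp add: N_sq ip_simps Re_ip_commute[of x y])

lemma N_diff_sq: "(N (x - y))\<^sup>2 = (N x)\<^sup>2 - 2 * Re (ip x y) + (N y)\<^sup>2"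
  by (simp add: N_sq ip_simps Re_ip_commute[of x y])

lemma N_triangle: "N (x + y) \<le> N x + N y"
proof (rule power2_le_imp_le)
  show "(N (x + y))\<^sup>2 \<le> (N x + N y)\<^sup>2"
    using Re_ip_le[of x y] by (simp add: N_add_sq power2_sum)
qed simp

lemma N_diff_triangle: "N (x - z) \<le> N (x - y) + N (y - z)"
  using N_triangle[of "x - y" "y - z"] by simp

section \<open>Completeness, sequential closedness and limits\<close>

lemma Metric_space_ip_dist: "Metric_space UNIV (ip_dist ip)"
proof
  show "ip_dist ip x z \<le> ip_dist ip x y + ip_dist ip y z" for x y z
    by (simp add: ip_dist_def N_diff_triangle)
qed (simp_all add: ip_dist_def N_minus_commute)

lemma complete:
  assumes "\<And>e. e > 0 \<Longrightarrow> \<exists>M. \<forall>m\<ge>M. \<forall>n\<ge>M. N (\<sigma> m - \<sigma> n) < e"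
  obtains x where "(\<lambda>n. N (\<sigma> n - x)) \<longlonglongrightarrow> 0"
proof -
  have "range \<sigma> \<subseteq> UNIV \<and> (\<forall>e>0. \<exists>M. \<forall>m\<ge>M. \<forall>n\<ge>M. ip_dist ip (\<sigma> m) (\<sigma> n) < e)"
    unfolding ip_dist_def using assms by (intro conjI allI impI subset_UNIV)
  then have "\<exists>x\<in>UNIV. (\<lambda>n. ip_dist ip (\<sigma> n) x) \<longlonglongrightarrow> 0"
    using hilbert[unfolded hilbert_inner_on_def, THEN conjunct2, THEN conjunct2, THEN spec] by (rule mp[rotated])
  then show ?thesis using that unfolding ip_dist_def by blast
qed

text \<open>Completeness in the form that the Baire category theorem asks for.\<close>

lemma mcomplete: "Metric_space.mcomplete UNIV (ip_dist ip)"
  unfolding Metric_space.mcomplete_def[OF Metric_space_ip_dist]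
proof (intro allI impI)
  fix \<sigma> :: "nat \<Rightarrow> 'a" assume "Metric_space.MCauchy UNIV (ip_dist ip) \<sigma>"
  then have "\<exists>M. \<forall>m\<ge>M. \<forall>n\<ge>M. N (\<sigma> m - \<sigma> n) < e" if "e > 0" for e
    using that unfolding Metric_space.MCauchy_def[OF Metric_space_ip_dist] ip_dist_def by meson
  then obtain x where "(\<lambda>n. N (\<sigma> n - x)) \<longlonglongrightarrow> 0"
    by (rule complete)
  then show "\<exists>x. limitin (Metric_space.mtopology UNIV (ip_dist ip)) \<sigma> x sequentially"
    unfolding Metric_space.limitin_metric_dist_null[OF Metric_space_ip_dist] ip_dist_def
    by (intro exI[of _ x]) simp
qed

text \<open>Closedness is phrased by sequences so that limits of \<open>ip\<close> and
  \<open>N\<close> apply directly; \<open>closedin_iff\<close> links it to the topology.\<close>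

definition seq_closed :: "'a set \<Rightarrow> bool" where
  "seq_closed S \<longleftrightarrow> (\<forall>\<sigma> x. range \<sigma> \<subseteq> S \<and> (\<lambda>n. N (\<sigma> n - x)) \<longlonglongrightarrow> 0 \<longrightarrow> x \<in> S)"

lemma closedin_iff: "closedin (Metric_space.mtopology UNIV (ip_dist ip)) S \<longleftrightarrow> seq_closed S"
  unfolding Metric_space.metric_closedin_iff_sequentially_closed[OF Metric_space_ip_dist]
    Metric_space.limitin_metric_dist_null[OF Metric_space_ip_dist] seq_closed_def ip_dist_def
  by simp

lemma tendsto_ip:
  assumes "(\<lambda>n. N (\<sigma> n - x)) \<longlonglongrightarrow> 0"
  shows "(\<lambda>n. ip (\<sigma> n) z) \<longlonglongrightarrow> ip x z"
proof (rule LIM_zero_cancel, rule Lim_null_comparison)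
  show "(\<lambda>n. N (\<sigma> n - x) * N z) \<longlonglongrightarrow> 0"
    using tendsto_mult_left_zero[OF assms] by simp
  show "\<forall>\<^sub>F n in sequentially. norm (ip (\<sigma> n) z - ip x z) \<le> N (\<sigma> n - x) * N z"
    using Cauchy_Schwarz[of "\<sigma> _ - x" z] by (simp add: ip_diff_left)
qed

lemma tendsto_N:
  assumes "(\<lambda>n. N (\<sigma> n - x)) \<longlonglongrightarrow> 0"
  shows "(\<lambda>n. N (\<sigma> n)) \<longlonglongrightarrow> N x"
proof (rule LIM_zero_cancel, rule Lim_null_comparison[OF _ assms])
  have "\<bar>N (\<sigma> n) - N x\<bar> \<le> N (\<sigma> n - x)" for n
    using N_diff_triangle[of "\<sigma> n" 0 x] N_diff_triangle[of x 0 "\<sigma> n"]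
    using N_triangle[of "\<sigma> n - x" x] N_triangle[of "x - \<sigma> n" "\<sigma> n"] N_minus_commute[of x "\<sigma> n"]
    by simp
  then show "\<forall>\<^sub>F n in sequentially. norm (N (\<sigma> n) - N x) \<le> N (\<sigma> n - x)" by simp
qed

lemma limit_add:
  assumes "(\<lambda>n. N (\<sigma> n - x)) \<longlonglongrightarrow> 0" "(\<lambda>n. N (\<tau> n - y)) \<longlonglongrightarrow> 0"
  shows "(\<lambda>n. N (\<sigma> n + \<tau> n - (x + y))) \<longlonglongrightarrow> 0"
proof (rule Lim_null_comparison)
  show "\<forall>\<^sub>F n in sequentially. norm (N (\<sigma> n + \<tau> n - (x + y))) \<le> N (\<sigma> n - x) + N (\<tau> n - y)"
    using N_triangle[of "\<sigma> _ - x" "\<tau> _ - y"] by (simp add: add_diff_add)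
  show "(\<lambda>n. N (\<sigma> n - x) + N (\<tau> n - y)) \<longlonglongrightarrow> 0"
    using tendsto_add[OF assms] by simp
qed

lemma limit_scale:
  assumes "(\<lambda>n. N (\<sigma> n - x)) \<longlonglongrightarrow> 0"
  shows "(\<lambda>n. N (smul c (\<sigma> n) - smul c x)) \<longlonglongrightarrow> 0"
  using tendsto_mult_right_zero[OF assms] by (simp add: N_scale flip: scale_right_diff_distrib)

lemma limit_unique:
  assumes "(\<lambda>n. N (\<sigma> n - x)) \<longlonglongrightarrow> 0" "(\<lambda>n. N (\<sigma> n - y)) \<longlonglongrightarrow> 0"
  shows "x = y"
proof -
  have "ip x (x - y) = ip y (x - y)"
    using tendsto_ip[OF assms(1)] tendsto_ip[OF assms(2)] LIMSEQ_unique by blast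
  then have "ip (x - y) (x - y) = 0" by (simp add: ip_diff_left)
  then show ?thesis using ip_pos[of "x - y"] by auto
qed

lemma eqI:
  assumes "\<And>z. ip x z = ip y z"
  shows "x = y"
proof -
  have "ip (x - y) (x - y) = 0" using assms by (simp add: ip_diff_left)
  then show ?thesis using ip_pos[of "x - y"] by auto
qed

lemma eqI_right:
  assumes "\<And>z. ip z x = ip z y"
  shows "x = y"
  using assms by (metis eqI ip_commute)

end

subsection \<open>Bounded operators\<close>

text \<open>First variation at a minimum: a nonzero linear term would dominate near
  \<open>t = 0\<close>. The witness divides by \<open>b + 1\<close>, so \<open>b = 0\<close> needs
  no separate case.\<close>

lemma real_quadratic_nonneg_imp_zero:
  fixes a b :: real
  assumes "\<And>t. 0 \<le> 2 * t * a + t\<^sup>2 * b" "b \<ge> 0"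
  shows "a = 0"
proof (rule ccontr)
  assume "a \<noteq> 0"
  let ?t = "- a / (b + 1)"
  have "2 * ?t * a + ?t\<^sup>2 * b = - (a\<^sup>2 * (b + 2)) / (b + 1)\<^sup>2"
    using assms(2) by (simp add: divide_simps power2_eq_square) (simp add: algebra_simps)
  moreover have "a\<^sup>2 * (b + 2) / (b + 1)\<^sup>2 > 0"
    using assms(2) \<open>a \<noteq> 0\<close> by (intro divide_pos_pos mult_pos_pos) auto
  ultimately show False using assms(1)[of ?t] by simp
qed

context complex_hilbert
begin

abbreviation lin :: "('a \<Rightarrow> 'a) \<Rightarrow> bool" where "lin \<equiv> Vector_Spaces.linear smul smul"

lemma lin_iff: "lin A \<longleftrightarrow> (\<forall>x y. A (x + y) = A x + A y) \<and> (\<forall>c x. A (smul c x) = smul c (A x))"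
  using vector_space_axioms by (simp add: Vector_Spaces.linear_iff)

lemma lin_add: "lin A \<Longrightarrow> A (x + y) = A x + A y"
  and lin_scale: "lin A \<Longrightarrow> A (smul c x) = smul c (A x)"
  by (simp_all add: lin_iff)

lemma lin_0: "lin A \<Longrightarrow> A 0 = 0"
  using lin_scale[of A 0 0] by simp

lemma lin_diff: "lin A \<Longrightarrow> A (x - y) = A x - A y"
  using lin_add[of A "x - y" y] by simp

definition bounded_op :: "('a \<Rightarrow> 'a) \<Rightarrow> bool" where
  "bounded_op A \<longleftrightarrow> lin A \<and> (\<exists>C. \<forall>x. N (A x) \<le> C * N x)"

lemma bounded_opI: "lin A \<Longrightarrow> (\<And>x. N (A x) \<le> C * N x) \<Longrightarrow> bounded_op A"
  unfolding bounded_op_def by blast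

lemma bounded_opE:
  assumes "bounded_op A"
  obtains C where "lin A" "C > 0" "\<And>x. N (A x) \<le> C * N x"
proof -
  obtain C where C: "\<And>x. N (A x) \<le> C * N x" using assms by (auto simp: bounded_op_def)
  have "N (A x) \<le> max C 1 * N x" for x
    using C[of x] mult_right_mono[of C "max C 1" "N x"] by simp
  then show ?thesis using that[of "max C 1"] assms by (simp add: bounded_op_def)
qed

lemma limit_bounded_op:
  assumes "bounded_op A" "(\<lambda>n. N (\<sigma> n - x)) \<longlonglongrightarrow> 0"
  shows "(\<lambda>n. N (A (\<sigma> n) - A x)) \<longlonglongrightarrow> 0"
proof -
  obtain C where C: "lin A" "\<And>x. N (A x) \<le> C * N x" using bounded_opE[OF assms(1)] by metis
  show ?thesis
  proof (rule Lim_null_comparison)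
    show "\<forall>\<^sub>F n in sequentially. norm (N (A (\<sigma> n) - A x)) \<le> C * N (\<sigma> n - x)"
      using C by (simp flip: lin_diff)
    show "(\<lambda>n. C * N (\<sigma> n - x)) \<longlonglongrightarrow> 0" using tendsto_mult_right_zero[OF assms(2)] .
  qed
qed

lemma seq_closed_kernel:
  assumes "bounded_op A"
  shows "seq_closed {x. A x = 0}"
  unfolding seq_closed_def
proof (intro allI impI, elim conjE)
  fix \<sigma> x assume \<sigma>: "range \<sigma> \<subseteq> {x. A x = 0}" and lim: "(\<lambda>n. N (\<sigma> n - x)) \<longlonglongrightarrow> 0"
  have "A (\<sigma> n) = 0" for n using \<sigma> by blast
  then have "N (A x) = 0"
    using limit_bounded_op[OF assms lim] by (simp add: N_minus LIMSEQ_const_iff)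
  then show "x \<in> {x. A x = 0}" by simp
qed

lemma subspace_kernel: "lin A \<Longrightarrow> subspace {x. A x = 0}"
  by (auto simp: subspace_def lin_0 lin_add lin_scale)

section \<open>Riesz representation, adjoints and orthogonal projections\<close>

lemma parallelogram: "(N (x + y))\<^sup>2 + (N (x - y))\<^sup>2 = 2 * (N x)\<^sup>2 + 2 * (N y)\<^sup>2"
  by (simp add: N_add_sq N_diff_sq)

text \<open>The representing vector minimises \<open>\<parallel>y\<parallel>\<^sup>2 - 2 Re (f y)\<close> over \<open>S\<close>.\<close>

lemma Riesz_representation_on:
  assumes S: "subspace S" "seq_closed S"
    and f_add: "\<And>x y. f (x + y) = f x + f y" and f_scale: "\<And>c x. f (smul c x) = c * f x"
    and bound: "\<And>x. cmod (f x) \<le> C * N x"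
  obtains z where "z \<in> S" "\<And>y. y \<in> S \<Longrightarrow> f y = ip y z"
proof -
  define \<Phi> where "\<Phi> y = (N y)\<^sup>2 - 2 * Re (f y)" for y
  define m where "m = Inf (\<Phi> ` S)"
  have lower: "\<Phi> y \<ge> - C\<^sup>2" for y
  proof -
    have "Re (f y) \<le> C * N y" using bound[of y] complex_Re_le_cmod[of "f y"] by linarith
    moreover have "0 \<le> (N y - C)\<^sup>2" by simp
    ultimately show ?thesis unfolding \<Phi>_def power2_diff by (simp add: mult.commute)
  qed
  have bdd: "bdd_below (\<Phi> ` S)" using lower by (intro bdd_belowI2)
  have m_le: "m \<le> \<Phi> y" if "y \<in> S" for y
    unfolding m_def using bdd that by (intro cInf_lower) auto
  have ne: "\<Phi> ` S \<noteq> {}" using subspace_0[OF S(1)] by blast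
  have "\<exists>y\<in>S. \<Phi> y < m + 1 / real (Suc n)" for n
    using cInf_lessD[OF ne, of "m + 1 / real (Suc n)"] by (auto simp: m_def)
  then obtain \<sigma> where \<sigma>: "\<And>n. \<sigma> n \<in> S" "\<And>n. \<Phi> (\<sigma> n) < m + 1 / real (Suc n)" by metis
  \<comment> \<open>The midpoint of \<open>y\<close> and \<open>w\<close> lies in \<open>S\<close>,
    so its value is at least \<open>m\<close>; with the parallelogram law this makes minimising
    sequences Cauchy.\<close>
  have dist: "(N (y - w))\<^sup>2 \<le> 2 * (\<Phi> y + \<Phi> w - 2 * m)" if "y \<in> S" "w \<in> S" for y w
  proof -
    let ?h = "smul (1/2) (y + w)"
    have "?h \<in> S" using that S(1) by (simp add: subspace_add subspace_scale)
    then have "m \<le> \<Phi> ?h" by (rule m_le)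
    moreover have "\<Phi> ?h = (N (y + w))\<^sup>2 / 4 - Re (f y) - Re (f w)"
      by (simp add: \<Phi>_def N_scale f_scale f_add power_divide) (simp add: field_simps)
    ultimately show ?thesis using parallelogram[of y w] by (simp add: \<Phi>_def)
  qed
  have "\<exists>M. \<forall>i\<ge>M. \<forall>j\<ge>M. N (\<sigma> i - \<sigma> j) < e" if "e > 0" for e :: real
  proof -
    obtain M where M: "1 / real (Suc M) < e\<^sup>2 / 4"
      using \<open>e > 0\<close> by (metis nat_approx_posE divide_pos_pos zero_less_numeral zero_less_power)
    have "N (\<sigma> i - \<sigma> j) < e" if "i \<ge> M" "j \<ge> M" for i j
    proof (rule power2_less_imp_less)
      have "\<Phi> (\<sigma> k) < m + e\<^sup>2 / 4" if "k \<ge> M" for k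
      proof -
        have "1 / real (Suc k) \<le> 1 / real (Suc M)" using that by (simp add: frac_le)
        then show ?thesis using \<sigma>(2)[of k] M by (meson add_strict_left_mono le_less_trans less_trans)
      qed
      from this[OF \<open>i \<ge> M\<close>] this[OF \<open>j \<ge> M\<close>] show "(N (\<sigma> i - \<sigma> j))\<^sup>2 < e\<^sup>2"
        using dist[OF \<sigma>(1) \<sigma>(1), of i j] by argo
    qed (use \<open>e > 0\<close> in simp)
    then show ?thesis by blast
  qed
  then obtain z where z: "(\<lambda>n. N (\<sigma> n - z)) \<longlonglongrightarrow> 0" by (rule complete)
  have "z \<in> S" using S(2) \<sigma>(1) z unfolding seq_closed_def by blast
  have f_diff: "f (x - y) = f x - f y" for x y
    using f_add[of "x - y" y] by simp
  have lim_f: "(\<lambda>n. f (\<sigma> n)) \<longlonglongrightarrow> f z"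
  proof (rule LIM_zero_cancel, rule Lim_null_comparison)
    show "\<forall>\<^sub>F n in sequentially. norm (f (\<sigma> n) - f z) \<le> C * N (\<sigma> n - z)"
      using bound by (simp flip: f_diff)
    show "(\<lambda>n. C * N (\<sigma> n - z)) \<longlonglongrightarrow> 0" using tendsto_mult_right_zero[OF z] .
  qed
  have "(\<lambda>n. \<Phi> (\<sigma> n)) \<longlonglongrightarrow> \<Phi> z"
    unfolding \<Phi>_def by (intro tendsto_intros tendsto_N z tendsto_Re lim_f)
  moreover have "(\<lambda>n. m + 1 / real (Suc n)) \<longlonglongrightarrow> m + 0"
    using LIMSEQ_inverse_real_of_nat
    by (intro tendsto_intros) (simp add: inverse_eq_divide)
  ultimately have "\<Phi> z \<le> m"
    using \<sigma>(2) LIMSEQ_le[of "\<lambda>n. \<Phi> (\<sigma> n)" "\<Phi> z" "\<lambda>n. m + 1 / real (Suc n)" m]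
    by (auto intro: less_imp_le)
  \<comment> \<open>\<open>z\<close> minimises \<open>\<Phi>\<close> over \<open>S\<close>, so the
    first variation along \<open>v\<close> vanishes.\<close>
  have Re_eq: "Re (f v) = Re (ip v z)" if "v \<in> S" for v
  proof -
    have "Re (ip z v) - Re (f v) = 0"
    proof (rule real_quadratic_nonneg_imp_zero)
      fix t :: real
      have "z + smul (of_real t) v \<in> S"
        using S(1) that \<open>z \<in> S\<close> by (simp add: subspace_add subspace_scale)
      then have "\<Phi> z \<le> \<Phi> (z + smul (of_real t) v)" using m_le \<open>\<Phi> z \<le> m\<close> by force
      then show "0 \<le> 2 * t * (Re (ip z v) - Re (f v)) + t\<^sup>2 * (N v)\<^sup>2"
        by (simp add: \<Phi>_def N_add_sq N_scale f_add f_scale ip_scale_right power_mult_distrib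
            algebra_simps)
    qed simp
    then show ?thesis by (simp add: Re_ip_commute)
  qed
  have "f v = ip v z" if "v \<in> S" for v
  proof (rule complex_eqI)
    \<comment> \<open>Multiplying by \<open>- \<i>\<close> turns the imaginary part into a real
      part, to which \<open>Re_eq\<close> applies.\<close>
    have "smul (- \<i>) v \<in> S" using S(1) that by (rule subspace_scale)
    from Re_eq[OF this] show "Im (f v) = Im (ip v z)"
      by (simp add: f_scale ip_scale_left del: scale_minus_left)
  qed (rule Re_eq[OF that])
  then show ?thesis using that \<open>z \<in> S\<close> by blast
qed

text \<open>\<open>A' y\<close> is the Riesz vector of the functional sending \<open>x\<close> to
  \<open>ip (A x) y\<close>. Uniqueness of that vector gives linearity, and testing with
  \<open>x = A' y\<close> gives the bound.\<close>

lemma adjoint_exists: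
  assumes "bounded_op A"
  obtains A' where "bounded_op A'" "\<And>x y. ip (A x) y = ip x (A' y)"
proof -
  obtain C where C: "lin A" "C > 0" "\<And>x. N (A x) \<le> C * N x" using bounded_opE[OF assms] by metis
  have "\<exists>z. \<forall>x. ip (A x) y = ip x z" for y
  proof -
    have "cmod (ip (A x) y) \<le> (C * N y) * N x" for x
      using Cauchy_Schwarz[of "A x" y] mult_right_mono[OF C(3)[of x], of "N y"]
      by (simp add: mult.assoc mult.commute[of "N x"])
    then obtain z where "\<And>x. x \<in> UNIV \<Longrightarrow> ip (A x) y = ip x z"
      by (rule Riesz_representation_on[of UNIV "\<lambda>x. ip (A x) y", rotated 4])
        (simp_all add: C(1) seq_closed_def lin_add lin_scale ip_simps)
    then show ?thesis by blast
  qed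
  then obtain A' where A': "\<And>x y. ip (A x) y = ip x (A' y)" by metis
  have "lin A'"
    unfolding lin_iff by (intro conjI allI; rule eqI_right) (simp_all add: ip_simps flip: A')
  moreover have "N (A' y) \<le> C * N y" for y
  proof (cases "A' y = 0")
    case False
    have "(N (A' y))\<^sup>2 \<le> N (A (A' y)) * N y"
      using Re_ip_le[of "A (A' y)" y] by (simp add: A' N_sq)
    also have "\<dots> \<le> (C * N (A' y)) * N y" by (intro mult_right_mono C) simp
    finally have "N (A' y) * N (A' y) \<le> N (A' y) * (C * N y)"
      by (simp add: power2_eq_square algebra_simps)
    moreover have "N (A' y) > 0" using False N_nonneg[of "A' y"] by (simp add: less_le)
    ultimately show ?thesis using mult_le_cancel_left_pos by blast
  qed (use C(2) in simp)
  ultimately show ?thesis using that A' unfolding bounded_op_def by blast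
qed

text \<open>\<open>P x\<close> is the Riesz vector in \<open>S\<close> of the functional sending
  \<open>y\<close> to \<open>ip y x\<close>. Uniqueness within \<open>S\<close> gives linearity, and
  testing with \<open>y = P x\<close> shows that \<open>P\<close> is a contraction.\<close>

lemma orthogonal_projection:
  assumes S: "subspace S" "seq_closed S"
  obtains P where "bounded_op P" "\<And>x. P x \<in> S" "\<And>x y. y \<in> S \<Longrightarrow> ip y (P x) = ip y x"
proof -
  have "\<exists>z\<in>S. \<forall>y\<in>S. ip y x = ip y z" for x
  proof -
    have "cmod (ip y x) \<le> N x * N y" for y using Cauchy_Schwarz[of y x] by (simp add: mult.commute)
    then obtain z where "z \<in> S" "\<And>y. y \<in> S \<Longrightarrow> ip y x = ip y z"
      by (rule Riesz_representation_on[OF S, of "\<lambda>y. ip y x", rotated 2]) (simp_all add: ip_simps)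
    then show ?thesis by blast
  qed
  then obtain P where P: "\<And>x. P x \<in> S" "\<And>x y. y \<in> S \<Longrightarrow> ip y x = ip y (P x)" by metis
  have unique: "u = v" if "u \<in> S" "v \<in> S" "\<And>y. y \<in> S \<Longrightarrow> ip y u = ip y v" for u v
  proof -
    have "ip (u - v) (u - v) = 0"
      using that subspace_diff[OF S(1), of u v] by (simp add: ip_diff_right)
    then show ?thesis using ip_pos[of "u - v"] by auto
  qed
  have "lin P"
    unfolding lin_iff
    by (intro conjI allI; rule unique)
      (simp_all add: P(1) subspace_add[OF S(1)] subspace_scale[OF S(1)] ip_simps flip: P(2))
  moreover have "N (P x) \<le> 1 * N x" for x
  proof -
    have "(N (P x))\<^sup>2 \<le> N (P x) * N x"
      using Re_ip_le[of "P x" x] P(2)[OF P(1), of x x] by (simp add: N_sq)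
    then show ?thesis
      by (cases "N (P x) = 0") (simp_all add: power2_eq_square mult_le_cancel_left_pos less_le)
  qed
  ultimately have "bounded_op P" unfolding bounded_op_def by blast
  then show ?thesis using P(1) P(2)[symmetric] by (rule that)
qed

text \<open>Hellinger--Toeplitz, in the form: an everywhere defined adjoint forces boundedness.\<close>

lemma bounded_op_if_adjoint:
  assumes T: "lin T" and adj: "\<And>x y. ip (T x) y = ip x (T' y)"
  shows "bounded_op T"
proof -
  let ?X = "Metric_space.mtopology UNIV (ip_dist ip)"
  \<comment> \<open>The sets \<open>F n\<close> are closed and cover the space, so by Baire one of
    them contains a ball, on which \<open>T\<close> is bounded.\<close>
  define F where "F n = {x. N (T x) \<le> real n}" for n :: nat
  have closed: "closedin ?X (F n)" for n
    unfolding closedin_iff seq_closed_def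
  proof (intro allI impI, elim conjE)
    fix \<sigma> x assume \<sigma>: "range \<sigma> \<subseteq> F n" and lim: "(\<lambda>i. N (\<sigma> i - x)) \<longlonglongrightarrow> 0"
    \<comment> \<open>Continuity of \<open>T\<close> is not yet available; moving \<open>T\<close>
      across \<open>ip\<close> makes the pairing with \<open>T x\<close> a continuous function of
      \<open>\<sigma> i\<close>.\<close>
    have "(\<lambda>i. cmod (ip (\<sigma> i) (T' (T x)))) \<longlonglongrightarrow> cmod (ip x (T' (T x)))"
      by (intro tendsto_norm tendsto_ip lim)
    moreover have "cmod (ip (\<sigma> i) (T' (T x))) \<le> real n * N (T x)" for i
    proof -
      have "N (T (\<sigma> i)) \<le> real n" using \<sigma> by (auto simp: F_def)
      then show ?thesis
        using Cauchy_Schwarz[of "T (\<sigma> i)" "T x"] mult_right_mono[of "N (T (\<sigma> i))" "real n" "N (T x)"]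
        by (simp add: adj)
    qed
    ultimately have "cmod (ip x (T' (T x))) \<le> real n * N (T x)"
      by (intro LIMSEQ_le_const2) auto
    then have "N (T x) * N (T x) \<le> real n * N (T x)"
      by (simp add: ip_N norm_power power2_eq_square norm_mult flip: adj)
    then show "x \<in> F n"
      by (cases "N (T x) = 0") (simp_all add: F_def mult_le_cancel_right_pos less_le)
  qed
  have "\<Union> (range F) = UNIV"
    by (auto simp: F_def real_arch_simple)
  then have "?X interior_of \<Union> (range F) \<noteq> {}"
    using interior_of_topspace[of ?X] by (simp add: Metric_space.topspace_mtopology[OF Metric_space_ip_dist])
  then have "\<not> (\<forall>n. ?X interior_of F n = {})"
    using Metric_space.metric_Baire_category_alt[OF Metric_space_ip_dist mcomplete, of "range F"] closed
    by (metis countableI_type countable_image rangeE)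
  then obtain n where "?X interior_of F n \<noteq> {}" by blast
  then obtain x0 U where U: "openin ?X U" "U \<subseteq> F n" "x0 \<in> U"
    by (auto simp: interior_of_def)
  then obtain r where "r > 0" and r: "Metric_space.mball UNIV (ip_dist ip) x0 r \<subseteq> F n"
    unfolding Metric_space.openin_mtopology[OF Metric_space_ip_dist] by blast
  have ball: "N (T (x0 + v)) \<le> real n" if "N v < r" for v
  proof -
    have "ip_dist ip x0 (x0 + v) = N v" by (simp add: ip_dist_def N_minus)
    then have "x0 + v \<in> F n"
      using r that by (simp add: subset_iff Metric_space.in_mball[OF Metric_space_ip_dist])
    then show ?thesis by (simp add: F_def)
  qed
  \<comment> \<open>\<open>T v\<close> is the difference of the values of \<open>T\<close> at
    \<open>x0 + v\<close> and \<open>x0\<close>, both points of the ball.\<close>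
  have small: "N (T v) \<le> 2 * real n" if "N v < r" for v
  proof -
    have "N (T v) \<le> N (T (x0 + v)) + N (T (x0 + 0))"
      using N_triangle[of "T (x0 + v)" "- T x0"] T by (simp add: lin_add N_minus)
    moreover have "N 0 < r" using \<open>r > 0\<close> N_eq_0 by metis
    ultimately show ?thesis using ball[OF that] ball[of 0] by linarith
  qed
  have "N (T u) \<le> (4 * real n / r) * N u" for u
  proof (cases "u = 0")
    case True
    then show ?thesis using lin_0[OF T] by simp
  next
    case False
    then have "N u > 0" using N_nonneg[of u] by (simp add: less_le)
    \<comment> \<open>The factor \<open>t\<close> scales \<open>u\<close> to norm
      \<open>r / 2\<close>, inside the ball.\<close>
    define t where "t = r / (2 * N u)"
    have "t > 0" using \<open>r > 0\<close> \<open>N u > 0\<close> by (simp add: t_def)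
    have "N (smul (of_real t) u) < r"
      using \<open>t > 0\<close> \<open>N u > 0\<close> \<open>r > 0\<close> by (simp add: N_scale) (simp add: t_def)
    then have "t * N (T u) \<le> 2 * real n"
      using small[of "smul (of_real t) u"] \<open>t > 0\<close> by (simp add: lin_scale[OF T] N_scale)
    then show ?thesis using \<open>r > 0\<close> \<open>N u > 0\<close> by (simp add: t_def field_simps)
  qed
  then show ?thesis using T unfolding bounded_op_def by blast
qed

section \<open>Algebra of bounded operators and operator square roots\<close>

lemma bounded_op_ident: "bounded_op (\<lambda>x. x)"
  unfolding bounded_op_def lin_iff by (auto intro: exI[of _ 1])

lemma bounded_op_scale:
  assumes "bounded_op A"
  shows "bounded_op (\<lambda>x. smul c (A x))"
proof -
  obtain C where C: "lin A" "\<And>x. N (A x) \<le> C * N x" using bounded_opE[OF assms] by metis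
  have "N (smul c (A x)) \<le> (cmod c * C) * N x" for x
    using mult_left_mono[OF C(2)[of x], of "cmod c"] by (simp add: N_scale mult.assoc)
  then show ?thesis
    by (rule bounded_opI[rotated]) (use C(1) in \<open>simp add: lin_iff scale_right_distrib mult.commute\<close>)
qed

lemma bounded_op_add:
  assumes "bounded_op A" "bounded_op B"
  shows "bounded_op (\<lambda>x. A x + B x)"
proof -
  obtain C where C: "lin A" "\<And>x. N (A x) \<le> C * N x" using bounded_opE[OF assms(1)] by metis
  obtain D where D: "lin B" "\<And>x. N (B x) \<le> D * N x" using bounded_opE[OF assms(2)] by metis
  have "N (A x + B x) \<le> (C + D) * N x" for x
    using N_triangle[of "A x" "B x"] C(2)[of x] D(2)[of x] by (simp add: distrib_right)
  then show ?thesis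
    by (rule bounded_opI[rotated]) (use C(1) D(1) in \<open>simp add: lin_iff scale_right_distrib add_ac\<close>)
qed

lemma bounded_op_diff:
  assumes "bounded_op A" "bounded_op B"
  shows "bounded_op (\<lambda>x. A x - B x)"
  using bounded_op_add[OF assms(1) bounded_op_scale[OF assms(2), of "-1"]] by simp

lemma bounded_op_compose:
  assumes "bounded_op A" "bounded_op B"
  shows "bounded_op (\<lambda>x. A (B x))"
proof -
  obtain C where C: "lin A" "C > 0" "\<And>x. N (A x) \<le> C * N x" using bounded_opE[OF assms(1)] by metis
  obtain D where D: "lin B" "\<And>x. N (B x) \<le> D * N x" using bounded_opE[OF assms(2)] by metis
  have "N (A (B x)) \<le> (C * D) * N x" for x
    using order_trans[OF C(3) mult_left_mono[OF D(2)]] C(2) by (simp add: mult.assoc)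
  then show ?thesis
    by (rule bounded_opI[rotated]) (use C(1) D(1) in \<open>simp add: lin_iff\<close>)
qed

text \<open>Visser's iteration \<open>Y\<^sub>0 = 0\<close>, \<open>Y\<^sub>n\<^sub>+\<^sub>1 = (X + Y\<^sub>n\<^sup>2) / 2\<close> converges to \<open>1 - \<surd>(1 - X)\<close>.  Its steps are
  dominated by those of the scalar iteration for \<open>X = 1\<close>, which increases to \<open>1\<close>.\<close>

lemma one_minus_sqrt_exists:
  assumes X: "lin X" "\<And>x. N (X x) \<le> N x"
  obtains Y where "lin Y" "\<And>x. N (Y x) \<le> N x" "\<And>x. smul 2 (Y x) = X x + Y (Y x)"
    "\<forall>D D'. lin D \<longrightarrow> (\<forall>x y. ip (D x) y = ip x (D' y)) \<longrightarrow> (\<forall>x. D (X x) = X (D x)) \<longrightarrow>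
      (\<forall>x. D (Y x) = Y (D x))"
proof -
  define Z where "Z = rec_nat (\<lambda>_. 0) (\<lambda>_ W x. smul (1/2) (X x + W (W x)))"
  have Z0: "Z 0 x = 0" and ZS: "Z (Suc n) x = smul (1/2) (X x + Z n (Z n x))" for n x
    by (simp_all add: Z_def)
  define y :: "nat \<Rightarrow> real" where "y = rec_nat 0 (\<lambda>_ t. (1 + t\<^sup>2) / 2)"
  have y0: "y 0 = 0" and yS: "y (Suc n) = (1 + (y n)\<^sup>2) / 2" for n
    by (simp_all add: y_def)
  have y01: "0 \<le> y n \<and> y n \<le> 1" for n
    by (induction n) (auto simp: y0 yS power_le_one)
  have yinc: "y n \<le> y (Suc n)" for n
    using zero_le_power2[of "y n - 1"] by (simp add: yS power2_diff)
  have "convergent y"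
    using y01 yinc by (intro Bseq_monoseq_convergent BseqI'[of _ 1])
      (auto simp: monoseq_Suc)
  then have "Cauchy y" by (rule convergent_Cauchy)
  have Zlin: "lin (Z n)" for n
  proof (induction n)
    case 0
    show ?case by (simp add: lin_iff Z0)
  next
    case (Suc n)
    then show ?case using X(1) by (simp add: lin_iff ZS algebra_simps)
  qed
  have Zbound: "N (Z n x) \<le> y n * N x" for n x
  proof (induction n arbitrary: x)
    case 0
    show ?case by (simp add: Z0 y0)
  next
    case (Suc n)
    have "N (Z n (Z n x)) \<le> (y n)\<^sup>2 * N x"
      using order_trans[OF Suc[of "Z n x"] mult_left_mono[OF Suc[of x], of "y n"]] y01[of n]
      by (simp add: power2_eq_square mult.assoc)
    then have "N (X x + Z n (Z n x)) \<le> (1 + (y n)\<^sup>2) * N x"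
      using N_triangle[of "X x" "Z n (Z n x)"] X(2)[of x] by (simp add: distrib_right)
    then show ?case by (simp add: ZS N_scale yS)
  qed
  have Zbound1: "N (Z n x) \<le> N x" for n x
    using Zbound[of n x] mult_right_mono[of "y n" 1 "N x"] y01[of n] by simp
  \<comment> \<open>Each iterate is a polynomial in \<open>X\<close> and inherits whatever commutes
    with \<open>X\<close>. Taking \<open>D = X\<close>, and then \<open>D\<close> an iterate, shows
    that the iterates commute with each other.\<close>
  have Zcomm: "D (Z n x) = Z n (D x)" if "lin D" "\<And>x. D (X x) = X (D x)" for D n x
  proof (induction n arbitrary: x)
    case 0
    show ?case using that(1) by (simp add: Z0 lin_0)
  next
    case (Suc n)
    then show ?case using that by (simp add: ZS lin_scale lin_add)
  qed
  have "X (Z n x) = Z n (X x)" for n x using Zcomm[OF X(1)] by simp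
  then have ZZ: "Z m (Z n x) = Z n (Z m x)" for m n x
    by (rule Zcomm[OF Zlin, OF sym])
  have step: "N (Z (Suc n) x - Z n x) \<le> (y (Suc n) - y n) * N x" for n x
  proof (induction n arbitrary: x)
    case 0
    show ?case using X(2)[of x] by (simp add: ZS Z0 y0 yS N_scale)
  next
    case (Suc n)
    let ?u = "Z (Suc n) x + Z n x"
    have "Z (Suc (Suc n)) x - Z (Suc n) x = smul (1/2) (Z (Suc n) (Z (Suc n) x) - Z n (Z n x))"
      unfolding ZS[of "Suc n" x] ZS[of n x] by (simp flip: scale_right_diff_distrib)
    \<comment> \<open>A difference of squares of commuting operators factors, so the induction
      hypothesis applies to \<open>?u\<close>. The same factorisation for \<open>y\<close> closes
      the induction.\<close>
    also have "Z (Suc n) (Z (Suc n) x) - Z n (Z n x) = Z (Suc n) ?u - Z n ?u"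
      by (simp add: lin_add[OF Zlin] ZZ[of n "Suc n"])
    finally have "N (Z (Suc (Suc n)) x - Z (Suc n) x) = N (Z (Suc n) ?u - Z n ?u) / 2"
      by (simp add: N_scale)
    also have "\<dots> \<le> ((y (Suc n) - y n) * N ?u) / 2"
      using Suc[of ?u] by simp
    also have "\<dots> \<le> ((y (Suc n) - y n) * ((y (Suc n) + y n) * N x)) / 2"
      using N_triangle[of "Z (Suc n) x" "Z n x"] Zbound[of "Suc n" x] Zbound[of n x] yinc[of n]
      by (intro divide_right_mono mult_left_mono) (auto simp: distrib_right)
    also have "\<dots> = (y (Suc (Suc n)) - y (Suc n)) * N x"
    proof -
      have "y (Suc (Suc n)) - y (Suc n) = (y (Suc n) - y n) * (y (Suc n) + y n) / 2"
      proof -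
        have "(y (Suc n) - y n) * (y (Suc n) + y n) = (y (Suc n))\<^sup>2 - (y n)\<^sup>2"
          by (simp add: power2_eq_square algebra_simps)
        then show ?thesis using yS[of "Suc n"] yS[of n] by argo
      qed
      then show ?thesis by simp
    qed
    finally show ?case .
  qed
  have dist: "N (Z m x - Z n x) \<le> \<bar>y m - y n\<bar> * N x" for m n x
  proof -
    have *: "N (Z (n + k) x - Z n x) \<le> (y (n + k) - y n) * N x" for n k
    proof (induction k)
      case (Suc k)
      show ?case
        using N_diff_triangle[of "Z (n + Suc k) x" "Z n x" "Z (n + k) x"] Suc step[of "n + k" x]
        by (simp add: algebra_simps)
    qed simp
    have **: "N (Z m x - Z n x) \<le> \<bar>y m - y n\<bar> * N x" if "n \<le> m" for m n
      using *[of n "m - n"] that mult_right_mono[OF abs_ge_self[of "y m - y n"], of "N x"] by simp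
    show ?thesis
      using **[of n m] **[of m n] N_minus_commute[of "Z m x"] abs_minus_commute[of "y m"]
      by (cases "n \<le> m") simp_all
  qed
  have "\<exists>z. (\<lambda>n. N (Z n x - z)) \<longlonglongrightarrow> 0" for x
  proof -
    have "\<exists>M. \<forall>m\<ge>M. \<forall>n\<ge>M. N (Z m x - Z n x) < e" if "e > 0" for e
    proof -
      \<comment> \<open>Adding \<open>1\<close> keeps the denominator positive when
        \<open>x = 0\<close>.\<close>
      have "e / (N x + 1) > 0" using that N_nonneg[of x] by (intro divide_pos_pos) linarith+
      then obtain M where M: "\<And>m n. \<lbrakk>m \<ge> M; n \<ge> M\<rbrakk> \<Longrightarrow> \<bar>y m - y n\<bar> < e / (N x + 1)"
        using \<open>Cauchy y\<close> unfolding Cauchy_def dist_real_def by meson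
      have "N (Z m x - Z n x) < e" if "m \<ge> M" "n \<ge> M" for m n
      proof -
        have "N (Z m x - Z n x) \<le> \<bar>y m - y n\<bar> * (N x + 1)"
          using dist[of m x n] by (simp add: distrib_left)
        also have "\<dots> < e" using M[OF that] N_nonneg[of x] by (simp add: pos_less_divide_eq add_nonneg_pos)
        finally show ?thesis .
      qed
      then show ?thesis by blast
    qed
    then show ?thesis using complete by metis
  qed
  then obtain Y where Y: "\<And>x. (\<lambda>n. N (Z n x - Y x)) \<longlonglongrightarrow> 0" by metis
  have Ylin: "lin Y"
    unfolding lin_iff
  proof (intro conjI allI)
    show "Y (u + v) = Y u + Y v" for u v
      by (rule limit_unique[OF Y]) (simp add: lin_add[OF Zlin] limit_add Y)
    show "Y (smul c u) = smul c (Y u)" for c u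
      by (rule limit_unique[OF Y]) (simp add: lin_scale[OF Zlin] limit_scale Y)
  qed
  have Ybound: "N (Y x) \<le> N x" for x
    using tendsto_N[OF Y] by (rule LIMSEQ_le_const2) (use Zbound1 in auto)
  \<comment> \<open>All iterates are contractions, so the inner \<open>Z n x\<close> may be replaced
    by its limit with an error bounded uniformly in the outer operator.\<close>
  have YY: "(\<lambda>n. N (Z n (Z n x) - Y (Y x))) \<longlonglongrightarrow> 0" for x
  proof (rule Lim_null_comparison)
    have "N (Z n (Z n x) - Y (Y x)) \<le> N (Z n x - Y x) + N (Z n (Y x) - Y (Y x))" for n
      using N_diff_triangle[of "Z n (Z n x)" "Y (Y x)" "Z n (Y x)"] Zbound1[of n "Z n x - Y x"]
      by (simp add: lin_diff[OF Zlin])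
    then show "\<forall>\<^sub>F n in sequentially. norm (N (Z n (Z n x) - Y (Y x)))
        \<le> N (Z n x - Y x) + N (Z n (Y x) - Y (Y x))"
      by simp
    show "(\<lambda>n. N (Z n x - Y x) + N (Z n (Y x) - Y (Y x))) \<longlonglongrightarrow> 0"
      using tendsto_add[OF Y[of x] Y[of "Y x"]] by simp
  qed
  have fixed: "Y x = smul (1/2) (X x + Y (Y x))" for x
  proof (rule limit_unique)
    show "(\<lambda>n. N (Z (Suc n) x - Y x)) \<longlonglongrightarrow> 0" using LIMSEQ_Suc[OF Y] .
    show "(\<lambda>n. N (Z (Suc n) x - smul (1/2) (X x + Y (Y x)))) \<longlonglongrightarrow> 0"
      unfolding ZS by (intro limit_scale limit_add YY) simp
  qed
  have Yeq: "smul 2 (Y x) = X x + Y (Y x)" for x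
    using arg_cong[OF fixed[of x], of "smul 2"] by simp
  \<comment> \<open>The adjoint \<open>D'\<close> moves \<open>D\<close> out of the way, so the
    commutation passes to the limit weakly, without continuity of \<open>D\<close>.\<close>
  have Ycomm: "D (Y x) = Y (D x)"
    if D: "lin D" "\<And>x y. ip (D x) y = ip x (D' y)" "\<And>x. D (X x) = X (D x)" for D D' x
  proof (rule eqI)
    fix z
    have "(\<lambda>n. ip (Z n x) (D' z)) \<longlonglongrightarrow> ip (Y x) (D' z)" by (rule tendsto_ip[OF Y])
    then have "(\<lambda>n. ip (Z n (D x)) z) \<longlonglongrightarrow> ip (D (Y x)) z"
      by (simp add: Zcomm[OF D(1,3)] flip: D(2))
    then show "ip (D (Y x)) z = ip (Y (D x)) z"
      using LIMSEQ_unique tendsto_ip[OF Y] by blast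
  qed
  show ?thesis by (rule that[OF Ylin Ybound Yeq]) (use Ycomm in blast)
qed

end

subsection \<open>Schur's lemma\<close>

text \<open>What Schur's lemma uses of the unitary group once the inner product is the one defined
  by \<open>g\<close>: linearity and closure under Hilbert adjoints.\<close>

locale adjoint_closed_operators = complex_hilbert +
  fixes G :: "('a \<Rightarrow> 'a) set"
  assumes G_lin: "h \<in> G \<Longrightarrow> lin h"
    and G_adjoint: "h \<in> G \<Longrightarrow> \<exists>h'\<in>G. \<forall>x y. ip (h x) y = ip x (h' y)"
begin

definition commutes :: "('a \<Rightarrow> 'a) \<Rightarrow> bool" where
  "commutes A \<longleftrightarrow> (\<forall>h\<in>G. \<forall>x. A (h x) = h (A x))"

definition closed_irreducible :: bool where
  "closed_irreducible \<longleftrightarrow>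
     (\<forall>S. subspace S \<and> seq_closed S \<and> invariant_under G S \<longrightarrow> S = {0} \<or> S = UNIV)"

lemma adjoint_sym: "(\<And>x y. ip (A x) y = ip x (A' y)) \<Longrightarrow> ip (A' x) y = ip x (A y)"
  by (metis ip_commute)

text \<open>The projection onto an invariant \<open>S\<close> commutes with \<open>G\<close>, hence
  equals \<open>smul c\<close>. If \<open>c = 0\<close> then \<open>S\<close> is zero; otherwise
  every \<open>x\<close> is a multiple of \<open>P x\<close>, which lies in
  \<open>S\<close>.\<close>

lemma closed_irreducible_if_commutant_scalar:
  assumes scalar: "\<And>A. bounded_op A \<Longrightarrow> commutes A \<Longrightarrow> \<exists>c. A = smul c"
  shows closed_irreducible
  unfolding closed_irreducible_def
proof (intro allI impI, elim conjE)
  fix S assume S: "subspace S" "seq_closed S" and inv: "invariant_under G S"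
  have GS: "h x \<in> S" if "h \<in> G" "x \<in> S" for h x
    using inv that unfolding invariant_under_def by blast
  obtain P where P: "bounded_op P" "\<And>x. P x \<in> S" "\<And>x y. y \<in> S \<Longrightarrow> ip y (P x) = ip y x"
    using orthogonal_projection[OF S] by metis
  have "P (h x) = h (P x)" if h: "h \<in> G" for h x
  proof -
    obtain h' where h': "h' \<in> G" "\<And>x y. ip (h x) y = ip x (h' y)" using G_adjoint[OF h] by blast
    \<comment> \<open>Pairing with an element of \<open>S\<close> does not distinguish a vector from
      its projection. This applies to \<open>?w\<close> and, since \<open>S\<close> is also
      invariant under the adjoint, to \<open>h' ?w\<close>.\<close>
    let ?w = "P (h x) - h (P x)"
    have w: "?w \<in> S" using S(1) P(2) GS[OF h] by (simp add: subspace_diff)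
    have "ip ?w (h (P x)) = ip (h' ?w) (P x)" by (rule adjoint_sym[OF h'(2), symmetric])
    also have "\<dots> = ip (h' ?w) x" by (rule P(3)[OF GS[OF h'(1) w]])
    also have "\<dots> = ip ?w (h x)" by (rule adjoint_sym[OF h'(2)])
    also have "\<dots> = ip ?w (P (h x))" by (rule P(3)[OF w, symmetric])
    finally have "ip ?w ?w = 0" unfolding ip_diff_right[of ?w] by simp
    then show ?thesis using ip_pos[of ?w] by fastforce
  qed
  then obtain c where c: "P = smul c" using scalar P(1) unfolding commutes_def by blast
  show "S = {0} \<or> S = UNIV"
  proof (cases "c = 0")
    case True
    have "y = 0" if "y \<in> S" for y
    proof (rule ccontr)
      assume "y \<noteq> 0"
      moreover have "ip y y = 0" using P(3)[OF that, of y] c True by simp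
      ultimately show False using ip_pos[of y] by simp
    qed
    then show ?thesis using subspace_0[OF S(1)] by blast
  next
    case False
    have "x \<in> S" for x
      using subspace_scale[OF S(1) P(2)[of x], of "1 / c"] c False by simp
    then show ?thesis by blast
  qed
qed

section \<open>The commutant of an irreducible family\<close>

context
  assumes irreducible: closed_irreducible
begin

text \<open>The kernel of a bounded operator in the commutant is a closed invariant
  subspace.\<close>

lemma commuting_kernel_trivial:
  assumes "bounded_op D" "commutes D"
  shows "(\<forall>x. D x = 0 \<longrightarrow> x = 0) \<or> (\<forall>x. D x = 0)"
proof -
  have "invariant_under G {x. D x = 0}"
    using assms(2) G_lin lin_0 unfolding invariant_under_def commutes_def by auto
  moreover have "subspace {x. D x = 0}" "seq_closed {x. D x = 0}"
    using subspace_kernel seq_closed_kernel assms(1) unfolding bounded_op_def by blast+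
  ultimately have "{x. D x = 0} = {0} \<or> {x. D x = 0} = UNIV"
    using irreducible unfolding closed_irreducible_def by blast
  then show ?thesis by blast
qed

text \<open>With \<open>C = \<bar>B\<bar>\<close> one has \<open>(C - B) (C + B) = 0\<close>, and the kernel of \<open>C - B\<close> is trivial or everything.\<close>

lemma commuting_selfadjoint_contraction_semidefinite:
  assumes B: "lin B" "\<And>x. N (B x) \<le> N x" and sa: "\<And>x y. ip (B x) y = ip x (B y)"
    and comm: "commutes B"
  shows "(\<forall>x. Re (ip (B x) x) \<ge> 0) \<or> (\<forall>x. Re (ip (B x) x) \<le> 0)"
proof -
  \<comment> \<open>With \<open>X\<close> equal to one minus the square of \<open>B\<close>, the
    operator \<open>C\<close> below, one minus \<open>Y\<close>, is the square root of the square of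
    \<open>B\<close>, that is, the absolute value of \<open>B\<close>.\<close>
  define X where "X x = x - B (B x)" for x
  have bB: "bounded_op B" using B by (intro bounded_opI[of _ 1]) auto
  have "bounded_op X" unfolding X_def by (rule bounded_op_diff[OF bounded_op_ident bounded_op_compose[OF bB bB]])
  then have Xlin: "lin X" by (simp add: bounded_op_def)
  have "N (X x) \<le> N x" for x
  proof (rule power2_le_imp_le)
    have "(N (X x))\<^sup>2 = (N x)\<^sup>2 - 2 * (N (B x))\<^sup>2 + (N (B (B x)))\<^sup>2"
      unfolding X_def N_diff_sq by (simp add: N_sq sa)
    moreover have "(N (B (B x)))\<^sup>2 \<le> (N (B x))\<^sup>2" using B(2) by (intro power_mono) auto
    ultimately show "(N (X x))\<^sup>2 \<le> (N x)\<^sup>2" using zero_le_power2[of "N (B x)"] by linarith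
  qed simp
  then obtain Y where Y: "lin Y" "\<And>x. N (Y x) \<le> N x" "\<And>x. smul 2 (Y x) = X x + Y (Y x)"
    and Y': "\<forall>D D'. lin D \<longrightarrow> (\<forall>x y. ip (D x) y = ip x (D' y)) \<longrightarrow> (\<forall>x. D (X x) = X (D x)) \<longrightarrow>
      (\<forall>x. D (Y x) = Y (D x))"
    by (rule one_minus_sqrt_exists[OF Xlin]) (rule that; assumption)
  have Ycomm: "D (Y x) = Y (D x)"
    if "lin D" "\<And>x y. ip (D x) y = ip x (D' y)" "\<And>x. D (X x) = X (D x)" for D D' x
    using Y' that by blast
  define C where "C x = x - Y x" for x
  have "bounded_op Y" using Y by (intro bounded_opI[of _ 1]) auto
  then have bC: "bounded_op C" unfolding C_def by (intro bounded_op_diff bounded_op_ident)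
  have "C (C x) = x - (Y x + Y x) + Y (Y x)" for x
    by (simp add: C_def lin_diff[OF Y(1)] algebra_simps)
  moreover have "Y x + Y x = X x + Y (Y x)" for x
    using Y(3)[of x] scale_left_distrib[of 1 1 "Y x"] by simp
  ultimately have CC: "C (C x) = B (B x)" for x
    by (simp add: X_def)
  have BC: "B (C x) = C (B x)" for x
    unfolding C_def lin_diff[OF B(1)]
    using Ycomm[OF B(1) sa, of x] by (simp add: X_def lin_diff[OF B(1)])
  have C_pos: "Re (ip (C x) x) \<ge> 0" for x
  proof -
    have "Re (ip (Y x) x) \<le> N x * N x"
      using Re_ip_le[of "Y x" x] mult_right_mono[OF Y(2)[of x], of "N x"] by simp
    then show ?thesis by (simp add: C_def ip_diff_left N_sq flip: power2_eq_square)
  qed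
  define D where "D x = C x - B x" for x
  have bD: "bounded_op D" unfolding D_def by (intro bounded_op_diff bC bB)
  have "commutes D"
    unfolding commutes_def
  proof (intro ballI allI)
    fix h x assume h: "h \<in> G"
    have hB: "B (h x) = h (B x)" for x using comm h by (simp add: commutes_def)
    obtain h' where h': "\<And>x y. ip (h x) y = ip x (h' y)" using G_adjoint[OF h] by blast
    \<comment> \<open>\<open>h\<close> commutes with \<open>B\<close>, hence with \<open>X\<close>,
      and has the adjoint \<open>h'\<close>, so it commutes with \<open>Y\<close>.\<close>
    have "h (Y x) = Y (h x)"
      by (rule Ycomm[OF G_lin[OF h] h']) (simp add: X_def hB lin_diff[OF G_lin[OF h]])
    then show "D (h x) = h (D x)"
      by (simp add: D_def C_def hB lin_diff[OF G_lin[OF h]])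
  qed
  with bD consider "\<And>x. D x = 0 \<Longrightarrow> x = 0" | "\<And>x. D x = 0"
    using commuting_kernel_trivial by blast
  then show ?thesis
  proof cases
    case 1
    \<comment> \<open>As \<open>B\<close> and \<open>C\<close> commute and have equal squares,
      \<open>(C - B) (C + B)\<close> vanishes; injectivity of \<open>D\<close> then leaves
      \<open>B = - C\<close>.\<close>
    have "D (C x + B x) = 0" for x
    proof -
      have "D (C x + B x) = C (C x) - B (B x) + (C (B x) - B (C x))"
        using bC B(1) by (simp add: D_def lin_add bounded_op_def)
      then show ?thesis by (simp add: CC BC)
    qed
    then have "C x + B x = 0" for x by (rule 1)
    then have "B x = - C x" for x by (simp add: eq_neg_iff_add_eq_0 add.commute)
    then show ?thesis using C_pos by (simp add: ip_minus_left)
  next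
    case 2
    then have "B x = C x" for x by (simp add: D_def)
    then show ?thesis using C_pos by simp
  qed
qed

text \<open>Every real shift of \<open>A\<close> is semidefinite, so the largest lower bound
  \<open>s\<close> of its normalised quadratic form is also an upper bound. The form of
  \<open>A - s\<close> then vanishes, and polarisation gives \<open>A = s\<close>.\<close>

lemma commuting_selfadjoint_scalar:
  assumes A: "bounded_op A" and sa: "\<And>x y. ip (A x) y = ip x (A y)" and comm: "commutes A"
  obtains c where "A = smul c"
proof (cases "\<exists>x0 :: 'a. x0 \<noteq> 0")
  \<comment> \<open>In the zero space the set \<open>L\<close> below would be unbounded and its
    supremum meaningless.\<close>
  case False
  then have "A = smul 0" by (metis ext)
  then show ?thesis by (rule that)
next
  case True
  then obtain x0 :: 'a where "x0 \<noteq> 0" by blast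
  obtain C where C: "lin A" "C > 0" "\<And>x. N (A x) \<le> C * N x" using bounded_opE[OF A] by metis
  define q where "q x = Re (ip (A x) x)" for x
  have q_bound: "\<bar>q x\<bar> \<le> C * (N x)\<^sup>2" for x
    using Re_ip_le[of "A x" x] mult_right_mono[OF C(3)[of x], of "N x"]
    by (simp add: q_def power2_eq_square mult.assoc)
  have dich: "(\<forall>x. l * (N x)\<^sup>2 \<le> q x) \<or> (\<forall>x. q x \<le> l * (N x)\<^sup>2)" for l
  proof -
    \<comment> \<open>\<open>C + \<bar>l\<bar>\<close> bounds the norm of \<open>A - l\<close>, so
      \<open>r\<close> normalises it to a contraction; the positive factor does not affect
      signs.\<close>
    define r where "r = 1 / (C + \<bar>l\<bar>)"
    have r: "r > 0" "r * (C + \<bar>l\<bar>) = 1" using C(2) by (auto simp: r_def)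
    define B where "B x = smul (of_real r) (A x - smul (of_real l) x)" for x
    have bB: "bounded_op B"
      unfolding B_def by (intro bounded_op_scale bounded_op_diff bounded_op_ident A)
    have "N (B x) \<le> N x" for x
    proof -
      have "N (A x - smul (of_real l) x) \<le> (C + \<bar>l\<bar>) * N x"
        using N_triangle[of "A x" "- smul (of_real l) x"] C(3)[of x]
        by (simp add: N_minus N_scale distrib_right)
      from mult_left_mono[OF this, of r] r show ?thesis
        by (simp add: B_def N_scale flip: mult.assoc)
    qed
    moreover have "ip (B x) y = ip x (B y)" for x y
      by (simp add: B_def ip_scale_left ip_scale_right ip_diff_left ip_diff_right sa)
    moreover have "commutes B"
      using comm G_lin unfolding commutes_def B_def by (simp add: lin_scale lin_diff)
    ultimately have "(\<forall>x. Re (ip (B x) x) \<ge> 0) \<or> (\<forall>x. Re (ip (B x) x) \<le> 0)"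
      using bB by (intro commuting_selfadjoint_contraction_semidefinite) (auto simp: bounded_op_def)
    moreover have "Re (ip (B x) x) = r * (q x - l * (N x)\<^sup>2)" for x
      by (simp add: B_def ip_scale_left ip_diff_left q_def N_sq)
    ultimately show ?thesis using r(1)
      by (simp add: zero_le_mult_iff mult_le_0_iff)
  qed
  define L where "L = {l. \<forall>x. l * (N x)\<^sup>2 \<le> q x}"
  define s where "s = Sup L"
  have "- C \<in> L" using q_bound by (auto simp: L_def abs_le_iff minus_le_iff)
  have L_le: "l \<le> q x / (N x)\<^sup>2" if "l \<in> L" "x \<noteq> 0" for l x
    using that by (simp add: L_def pos_le_divide_eq)
  have q_eq: "q x = s * (N x)\<^sup>2" for x
  proof (cases "x = 0")
    case True
    then show ?thesis by (simp add: q_def)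
  next
    case False
    have "s \<le> q x / (N x)\<^sup>2"
      unfolding s_def using \<open>- C \<in> L\<close> L_le[OF _ False] by (intro cSup_least) auto
    \<comment> \<open>Any \<open>l\<close> above \<open>s\<close> fails to be a lower bound, so by
      \<open>dich\<close> it is an upper bound; then \<open>l\<close> decreases to
      \<open>s\<close>.\<close>
    moreover have "q x / (N x)\<^sup>2 \<le> s"
    proof (rule dense_ge)
      fix l assume "s < l"
      have "l \<notin> L"
      proof
        assume "l \<in> L"
        moreover have "bdd_above L" using L_le[OF _ \<open>x0 \<noteq> 0\<close>] by (intro bdd_aboveI)
        ultimately have "l \<le> s" unfolding s_def by (rule cSup_upper)
        then show False using \<open>s < l\<close> by simp
      qed
      then have "q x \<le> l * (N x)\<^sup>2" using dich[of l] by (auto simp: L_def)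
      then show "q x / (N x)\<^sup>2 \<le> l" using False by (simp add: pos_divide_le_eq)
    qed
    ultimately show ?thesis using False by (simp add: eq_divide_eq)
  qed
  define B where "B x = A x - smul (of_real s) x" for x
  have B0: "Re (ip (B x) x) = 0" for x
    using q_eq[of x] by (simp add: B_def ip_simps q_def N_sq)
  have "bounded_op B" unfolding B_def by (intro bounded_op_diff bounded_op_scale bounded_op_ident A)
  then have Blin: "lin B" by (simp add: bounded_op_def)
  have Bsa: "ip (B x) y = ip x (B y)" for x y
    by (simp add: B_def ip_simps sa)
  have "B x = 0" for x
  proof -
    \<comment> \<open>At \<open>x + B x\<close> the cross terms of the vanishing form add up to
      twice the squared norm of \<open>B x\<close>.\<close>
    have "Re (ip (B (x + B x)) (x + B x)) = Re (ip (B x) x) + 2 * (N (B x))\<^sup>2 + Re (ip (B (B x)) (B x))"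
      by (simp add: lin_add[OF Blin] ip_simps N_sq Bsa[of "B x" x])
    then show ?thesis by (simp add: B0)
  qed
  then have "A = smul (of_real s)" by (auto simp: B_def)
  then show ?thesis by (rule that)
qed

text \<open>Cartesian decomposition \<open>A = B1 + \<i> B2\<close> into selfadjoint parts. The
  adjoint \<open>A'\<close> lies in the commutant because \<open>G\<close> is closed under adjoints,
  so both parts are scalar.\<close>

lemma commutant_scalar:
  assumes A: "bounded_op A" and comm: "commutes A"
  obtains c where "A = smul c"
proof -
  obtain A' where A': "bounded_op A'" "\<And>x y. ip (A x) y = ip x (A' y)"
    using adjoint_exists[OF A] by metis
  have A'': "ip (A' x) y = ip x (A y)" for x y by (rule adjoint_sym[OF A'(2)])
  have comm': "A' (h x) = h (A' x)" if h: "h \<in> G" for h x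
  proof (rule eqI)
    fix y
    obtain h' where h': "h' \<in> G" "\<And>x y. ip (h x) y = ip x (h' y)" using G_adjoint[OF h] by blast
    have "A (h' y) = h' (A y)" using comm h'(1) by (simp add: commutes_def)
    then show "ip (A' (h x)) y = ip (h (A' x)) y" by (simp add: A'' h'(2))
  qed
  define B1 where "B1 x = smul (1/2) (A x + A' x)" for x
  define B2 where "B2 x = smul (- \<i>/2) (A x - A' x)" for x
  have "bounded_op B1" "bounded_op B2"
    unfolding B1_def B2_def by (intro bounded_op_scale bounded_op_add bounded_op_diff A A'(1))+
  moreover have "commutes B1" "commutes B2"
    using comm comm' G_lin unfolding commutes_def B1_def B2_def
    by (simp_all add: lin_scale lin_diff lin_add)
  moreover have "ip (B1 x) y = ip x (B1 y)" "ip (B2 x) y = ip x (B2 y)" for x y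
    by (simp_all add: B1_def B2_def ip_scale_left ip_scale_right ip_add_left ip_add_right
        ip_diff_left ip_diff_right A'(2) A'' algebra_simps)
  ultimately obtain c1 c2 where c: "B1 = smul c1" "B2 = smul c2"
    using commuting_selfadjoint_scalar by metis
  have "A x = B1 x + smul \<i> (B2 x)" for x
  proof -
    have "B1 x + smul \<i> (B2 x) = smul (1/2) ((A x + A' x) + (A x - A' x))"
      unfolding scale_right_distrib[of "1/2" "A x + A' x"] by (simp add: B1_def B2_def)
    also have "(A x + A' x) + (A x - A' x) = smul 2 (A x)"
      using scale_left_distrib[of 1 1 "A x"] by simp
    finally show ?thesis by simp
  qed
  then have "A = smul (c1 + \<i> * c2)" by (auto simp: c scale_left_distrib)
  then show ?thesis by (rule that)
qed

end

theorem commutant_scalar_iff_closed_irreducible: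
  "(\<forall>A. bounded_op A \<and> commutes A \<longrightarrow> (\<exists>c. A = smul c)) \<longleftrightarrow> closed_irreducible"
  using closed_irreducible_if_commutant_scalar commutant_scalar by metis

end

subsection \<open>Krein spaces\<close>

lemma tendsto_0_le_mult:
  fixes f g :: "nat \<Rightarrow> real"
  assumes "f \<longlonglongrightarrow> 0" "\<And>n. 0 \<le> g n" "\<And>n. g n \<le> K * f n"
  shows "g \<longlonglongrightarrow> 0"
proof (rule Lim_null_comparison)
  show "\<forall>\<^sub>F n in sequentially. norm (g n) \<le> K * f n" using assms(2,3) by simp
  show "(\<lambda>n. K * f n) \<longlonglongrightarrow> 0" using tendsto_mult_right_zero[OF assms(1)] .
qed

text \<open>Transfers closedness and boundedness between the norm of the chosen fundamental
  symmetry, which the definitions use, and the norm defined by \<open>g\<close>.\<close>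

locale equivalent_hilbert = complex_hilbert smul ip + alt: complex_hilbert smul ip'
  for smul :: "complex \<Rightarrow> 'a::ab_group_add \<Rightarrow> 'a" and ip ip' :: "'a \<Rightarrow> 'a \<Rightarrow> complex" +
  fixes K :: real
  assumes K_pos: "K > 0"
    and le1: "ip_norm ip x \<le> K * ip_norm ip' x"
    and le2: "ip_norm ip' x \<le> K * ip_norm ip x"
begin

lemma norm_tendsto_iff:
  "(\<lambda>n. ip_norm ip (\<sigma> n - x)) \<longlonglongrightarrow> 0 \<longleftrightarrow> (\<lambda>n. ip_norm ip' (\<sigma> n - x)) \<longlonglongrightarrow> 0"
proof
  assume "(\<lambda>n. ip_norm ip (\<sigma> n - x)) \<longlonglongrightarrow> 0"
  then show "(\<lambda>n. ip_norm ip' (\<sigma> n - x)) \<longlonglongrightarrow> 0"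
    by (rule tendsto_0_le_mult[where K = K]) (simp_all add: le2)
next
  assume "(\<lambda>n. ip_norm ip' (\<sigma> n - x)) \<longlonglongrightarrow> 0"
  then show "(\<lambda>n. ip_norm ip (\<sigma> n - x)) \<longlonglongrightarrow> 0"
    by (rule tendsto_0_le_mult[where K = K]) (simp_all add: le1)
qed

lemma seq_closed_iff: "seq_closed S \<longleftrightarrow> alt.seq_closed S"
  by (simp add: seq_closed_def alt.seq_closed_def norm_tendsto_iff)

lemma bounded_op_iff: "bounded_op A \<longleftrightarrow> alt.bounded_op A"
proof
  assume "bounded_op A"
  then obtain C where C: "lin A" "C > 0" "\<And>x. ip_norm ip (A x) \<le> C * ip_norm ip x"
    using bounded_opE by metis
  have "ip_norm ip' (A x) \<le> (K * C * K) * ip_norm ip' x" for x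
  proof -
    have "ip_norm ip' (A x) \<le> K * (C * (K * ip_norm ip' x))"
      using le2[of "A x"] C(2,3) le1[of x] K_pos
      by (meson order_trans mult_left_mono less_imp_le)
    then show ?thesis by (simp add: mult.assoc)
  qed
  then show "alt.bounded_op A" using C(1) by (rule alt.bounded_opI[rotated])
next
  assume "alt.bounded_op A"
  then obtain C where C: "lin A" "C > 0" "\<And>x. ip_norm ip' (A x) \<le> C * ip_norm ip' x"
    using alt.bounded_opE by metis
  have "ip_norm ip (A x) \<le> (K * C * K) * ip_norm ip x" for x
  proof -
    have "ip_norm ip (A x) \<le> K * (C * (K * ip_norm ip x))"
      using le1[of "A x"] C(2,3) le2[of x] K_pos
      by (meson order_trans mult_left_mono less_imp_le)
    then show ?thesis by (simp add: mult.assoc)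
  qed
  then show "bounded_op A" using C(1) by (rule bounded_opI[rotated])
qed

end

text \<open>Comparing the quadratic forms makes \<open>ip'\<close> definite and carries Cauchy
  sequences and limits over, so completeness of \<open>ip'\<close> is inherited from
  \<open>ip\<close>.\<close>

lemma equivalent_hilbertI:
  assumes "complex_hilbert smul ip" "hermitian_form smul ip'"
    and CD: "C > 0" "D > 0"
    and upper: "\<And>x. Re (ip' x x) \<le> C * Re (ip x x)"
    and lower: "\<And>x. Re (ip x x) \<le> D * Re (ip' x x)"
  obtains K where "equivalent_hilbert smul ip ip' K"
proof -
  interpret complex_hilbert smul ip by fact
  interpret alt: hermitian_form smul ip' by fact
  define K where "K = max (sqrt C) (sqrt D)"
  have K: "K > 0" "sqrt C \<le> K" "sqrt D \<le> K" using CD by (auto simp: K_def less_max_iff_disj)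
  have pos: "Re (ip' x x) > 0" if "x \<noteq> 0" for x
    using lower[of x] ip_pos[OF that] CD(2) by (metis less_le_trans zero_less_mult_pos)
  have nonneg: "Re (ip' x x) \<ge> 0" for x using pos[of x] by (cases "x = 0") auto
  have le1: "ip_norm ip x \<le> K * ip_norm ip' x" for x
  proof -
    have "ip_norm ip x \<le> sqrt D * ip_norm ip' x"
      using lower[of x] by (simp add: ip_norm_def flip: real_sqrt_mult)
    also have "\<dots> \<le> K * ip_norm ip' x"
      using K(3) nonneg by (intro mult_right_mono) (simp_all add: ip_norm_def)
    finally show ?thesis .
  qed
  have le2: "ip_norm ip' x \<le> K * ip_norm ip x" for x
  proof -
    have "ip_norm ip' x \<le> sqrt C * ip_norm ip x"
      using upper[of x] by (simp add: ip_norm_def flip: real_sqrt_mult)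
    also have "\<dots> \<le> K * ip_norm ip x"
      using K(2) by (intro mult_right_mono) simp_all
    finally show ?thesis .
  qed
  have complete': "\<exists>x. (\<lambda>n. ip_norm ip' (\<sigma> n - x)) \<longlonglongrightarrow> 0"
    if cauchy: "\<And>e. e > 0 \<Longrightarrow> \<exists>M. \<forall>m\<ge>M. \<forall>n\<ge>M. ip_norm ip' (\<sigma> m - \<sigma> n) < e" for \<sigma>
  proof -
    have "\<exists>M. \<forall>m\<ge>M. \<forall>n\<ge>M. ip_norm ip (\<sigma> m - \<sigma> n) < e" if "e > 0" for e
    proof -
      obtain M where M: "\<And>m n. \<lbrakk>m \<ge> M; n \<ge> M\<rbrakk> \<Longrightarrow> ip_norm ip' (\<sigma> m - \<sigma> n) < e / K"
        using cauchy[of "e / K"] \<open>e > 0\<close> K(1) by auto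
      have "ip_norm ip (\<sigma> m - \<sigma> n) < e" if "m \<ge> M" "n \<ge> M" for m n
        using le1[of "\<sigma> m - \<sigma> n"] M[OF that] K(1) by (simp add: field_simps)
      then show ?thesis by blast
    qed
    then obtain x where "(\<lambda>n. ip_norm ip (\<sigma> n - x)) \<longlonglongrightarrow> 0" by (rule complete)
    then have "(\<lambda>n. ip_norm ip' (\<sigma> n - x)) \<longlonglongrightarrow> 0"
      by (rule tendsto_0_le_mult[where K = K]) (use le2 nonneg in \<open>simp_all add: ip_norm_def\<close>)
    then show ?thesis by blast
  qed
  have "hilbert_inner_on smul ip' UNIV"
    unfolding hilbert_inner_on_def ip_dist_def
    using alt.hermitian pos complete' by simp
  then have "complex_hilbert smul ip'"
    by unfold_locales
  then have "equivalent_hilbert smul ip ip' K"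
    using assms(1) K(1) le1 le2
    by (intro equivalent_hilbert.intro equivalent_hilbert_axioms.intro)
  then show ?thesis by (rule that)
qed

text \<open>For \<open>T = J g\<close> the new inner product is \<open>(T x, x)\<close>, and both \<open>T\<close> and \<open>T\<^sup>-\<^sup>1 = g J\<close> are bounded by
  Hellinger--Toeplitz.\<close>

lemma positive_involution_equivalent:
  assumes vs: "vector_space smul" and herm: "hermitian_form_on smul form UNIV"
    and J: "fundamental_symmetry_on smul form UNIV J"
    and g: "Vector_Spaces.linear smul smul g" and gg: "\<And>x. g (g x) = x"
    and sa: "\<And>x y. form (g x) y = form x (g y)" and pos: "\<And>x. Re (form (g x) x) \<ge> 0"
  obtains K where "equivalent_hilbert smul (\<lambda>x y. form (J x) y) (\<lambda>x y. form (g x) y) K"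
proof -
  interpret hermitian_form smul form
    using vs herm by (simp add: hermitian_form_def hermitian_form_axioms_def)
  have hilb: "complex_hilbert smul (\<lambda>x y. form (J x) y)"
    using vs J by (simp add: complex_hilbert_def complex_hilbert_axioms_def fundamental_symmetry_on_def)
  interpret H: complex_hilbert smul "\<lambda>x y. form (J x) y" by (rule hilb)
  have Jadd: "J (x + y) = J x + J y" and Jscale: "J (smul c x) = smul c (J x)" and JJ: "J (J x) = x"
    for x y c using J unfolding fundamental_symmetry_on_def by auto
  have gadd: "g (x + y) = g x + g y" and gscale: "g (smul c x) = smul c (g x)" for x y c
    using g by (simp_all add: H.lin_iff)
  \<comment> \<open>Both \<open>form\<close> and the inner product of \<open>J\<close> are
    Hermitian; together this makes \<open>J\<close> selfadjoint for \<open>form\<close>.\<close>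
  have Jsa: "form (J x) y = form x (J y)" for x y
    by (metis H.ip_commute ip_commute)
  have g_hermitian: "hermitian_form smul (\<lambda>x y. form (g x) y)"
  proof
    show "hermitian_form_on smul (\<lambda>x y. form (g x) y) UNIV"
      unfolding hermitian_form_on_def
      by (simp add: gadd gscale ip_add_left ip_scale_left) (metis sa ip_commute)
  qed
  interpret Hg: hermitian_form smul "\<lambda>x y. form (g x) y" by (rule g_hermitian)
  \<comment> \<open>The operators \<open>J g\<close> and \<open>g J\<close> are selfadjoint for the
    inner product of \<open>J\<close>, so each serves as its own \<open>T'\<close>.\<close>
  have "H.bounded_op (\<lambda>x. J (g x))"
    by (rule H.bounded_op_if_adjoint[where T' = "\<lambda>x. J (g x)"])
      (simp_all add: H.lin_iff gadd gscale Jadd Jscale JJ sa, simp add: Jsa JJ)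
  then obtain C where C: "C > 0" "\<And>x. H.N (J (g x)) \<le> C * H.N x"
    using H.bounded_opE by metis
  have "H.bounded_op (\<lambda>x. g (J x))"
    by (rule H.bounded_op_if_adjoint[where T' = "\<lambda>x. g (J x)"])
      (simp_all add: H.lin_iff gadd gscale Jadd Jscale, simp add: Jsa JJ sa)
  then obtain D where D: "D > 0" "\<And>x. H.N (g (J x)) \<le> D * H.N x"
    using H.bounded_opE by metis
  have upper: "Re (form (g x) x) \<le> C * Re (form (J x) x)" for x
  proof -
    have "Re (form (g x) x) \<le> H.N (J (g x)) * H.N x"
      using H.Re_ip_le[of "J (g x)" x] by (simp add: JJ)
    also have "\<dots> \<le> C * H.N x * H.N x" by (intro mult_right_mono C) simp
    finally show ?thesis using H.N_sq[of x] by (simp add: power2_eq_square mult.assoc)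
  qed
  have lower: "Re (form (J x) x) \<le> D * Re (form (g x) x)" for x
  proof (cases "x = 0")
    case True
    then show ?thesis by simp
  next
    case False
    let ?n = "Re (form (J x) x)"
    have n: "?n > 0" by (rule H.ip_pos[OF False])
    \<comment> \<open>In the form of \<open>g\<close>, the pairing of \<open>g (J x)\<close> with
      \<open>x\<close> is \<open>?n\<close>. Cauchy-Schwarz for that form and the bound on
      \<open>g J\<close> give an estimate from which one factor \<open>?n\<close> cancels.\<close>
    have "form (g (g (J x))) x = of_real ?n" using H.ip_self[of x] by (simp add: gg)
    then have "?n\<^sup>2 = (cmod (form (g (g (J x))) x))\<^sup>2" by simp
    also have "\<dots> \<le> Re (form (g (g (J x))) (g (J x))) * Re (form (g x) x)"
      by (rule Hg.Cauchy_Schwarz_semidefinite[OF pos])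
    also have "Re (form (g (g (J x))) (g (J x))) \<le> D * ?n"
    proof -
      have "Re (form (g (g (J x))) (g (J x))) \<le> H.N x * H.N (g (J x))"
        using H.Re_ip_le[of x "g (J x)"] by (simp add: gg)
      also have "\<dots> \<le> H.N x * (D * H.N x)" by (intro mult_left_mono D) simp
      finally show ?thesis using H.N_sq[of x] by (simp add: power2_eq_square ac_simps)
    qed
    finally have "?n * ?n \<le> ?n * (D * Re (form (g x) x))"
      using pos[of x] by (simp add: power2_eq_square ac_simps mult_right_mono)
    then show ?thesis using n mult_le_cancel_left_pos by blast
  qed
  show ?thesis
    using equivalent_hilbertI[OF hilb g_hermitian C(1) D(1) upper lower] that by blast
qed

section \<open>Equivalence of the three notions of irreducibility\<close>

theorem corollary2p16:
  fixes smul :: "complex \<Rightarrow> 'a::ab_group_add \<Rightarrow> 'a"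
    and form :: "'a \<Rightarrow> 'a \<Rightarrow> complex"
    and G :: "('a \<Rightarrow> 'a) set"
  assumes "krein_space smul form"
    and "unitary_operator_group smul form G"
    and "fundamental_representation form G"
  shows "(regularly_irreducible smul form G \<longleftrightarrow> operator_irreducible smul form G) \<and>
         (operator_irreducible smul form G \<longleftrightarrow> topologically_irreducible smul form G)"
proof -
  have vs: "vector_space smul" and herm: "hermitian_form_on smul form UNIV"
    and "\<exists>J. fundamental_symmetry_on smul form UNIV J"
    using assms(1) by (auto simp: krein_space_on_def)
  \<comment> \<open>The same choice as in \<open>krein_inner\<close>, so the norm and topology of
    the definitions are those of this \<open>J\<close>.\<close>
  define J where "J = (SOME J. fundamental_symmetry_on smul form UNIV J)"
  have J: "fundamental_symmetry_on smul form UNIV J"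
    unfolding J_def using \<open>\<exists>J. _\<close> by (rule someI_ex)
  have krein_inner: "krein_inner smul form = (\<lambda>x y. form (J x) y)"
    by (simp add: krein_inner_def J_def Let_def)
  have unitary: "Vector_Spaces.linear smul smul h" "bij h" "form (h x) y = form x (inv_into UNIV h y)"
    if "h \<in> G" for h x y
    using assms(2) that unfolding unitary_operator_group_def krein_unitary_def krein_adjoint_def by auto
  have subG: "subgroup G (BijGroup UNIV)" using assms(2) by (simp add: unitary_operator_group_def)
  have G_comp: "h \<circ> k \<in> G" if "h \<in> G" "k \<in> G" for h k
    using subgroup.m_closed[OF subG that] subgroup.mem_carrier[OF subG] that
    by (simp add: BijGroup_def compose_def comp_def restrict_UNIV)
  have G_inv: "inv_into UNIV h \<in> G" if "h \<in> G" for h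
  proof -
    have "h \<in> Bij UNIV" using subgroup.mem_carrier[OF subG that] by (simp add: BijGroup_def)
    then show ?thesis
      using subgroup.m_inv_closed[OF subG that] by (simp add: inv_BijGroup restrict_UNIV)
  qed
  obtain g where gG: "g \<in> G" and "krein_adjoint form g g" "g = inv_into UNIV g" "krein_positive form g"
    using assms(3) unfolding fundamental_representation_def by blast
  then have gsa: "form (g x) y = form x (g y)" and gpos: "Re (form (g x) x) \<ge> 0" for x y
    by (auto simp: krein_adjoint_def krein_positive_def complex_nonneg_Reals_iff)
  have gg: "g (g x) = x" for x
    using \<open>g = inv_into UNIV g\<close> unitary(2)[OF gG] by (metis bij_inv_eq_iff)
  obtain K where "equivalent_hilbert smul (\<lambda>x y. form (J x) y) (\<lambda>x y. form (g x) y) K"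
    by (rule positive_involution_equivalent[of smul form J g, OF vs herm J unitary(1)[OF gG] gg gsa gpos])
  then interpret E: equivalent_hilbert smul "\<lambda>x y. form (J x) y" "\<lambda>x y. form (g x) y" K .
  interpret A: adjoint_closed_operators smul "\<lambda>x y. form (g x) y" G
  proof (intro adjoint_closed_operators.intro adjoint_closed_operators_axioms.intro
      E.alt.complex_hilbert_axioms)
    show "Vector_Spaces.linear smul smul h" if "h \<in> G" for h by (rule unitary(1)[OF that])
    show "\<exists>h'\<in>G. \<forall>x y. form (g (h x)) y = form (g x) (h' y)" if "h \<in> G" for h
    \<comment> \<open>The Krein adjoint of \<open>h\<close> is its inverse; passing to the inner
      product of \<open>g\<close> conjugates it by \<open>g\<close>.\<close>
    proof (rule bexI[of _ "g \<circ> inv_into UNIV h \<circ> g"])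
      show "g \<circ> inv_into UNIV h \<circ> g \<in> G" using that gG by (intro G_comp G_inv)
      show "\<forall>x y. form (g (h x)) y = form (g x) ((g \<circ> inv_into UNIV h \<circ> g) y)"
        by (simp add: gsa gg unitary(3)[OF that])
    qed
  qed
  have closed: "closed_subspace smul form S \<longleftrightarrow> module.subspace smul S \<and> E.alt.seq_closed S" for S
    unfolding closed_subspace_def krein_topology_def krein_inner E.closedin_iff E.seq_closed_iff ..
  have "bounded_operator smul form B \<longleftrightarrow> E.alt.bounded_op B" for B
    unfolding bounded_operator_def krein_norm_def krein_inner
    by (simp add: E.bounded_op_def flip: E.bounded_op_iff)
  then have op: "operator_irreducible smul form G \<longleftrightarrow> A.closed_irreducible"
    unfolding operator_irreducible_def A.commutant_scalar_iff_closed_irreducible[symmetric]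
      A.commutes_def by (simp add: fun_eq_iff)
  have top: "topologically_irreducible smul form G \<longleftrightarrow> A.closed_irreducible"
    by (simp add: topologically_irreducible_def closed A.closed_irreducible_def)
  have "regular_subspace smul form S"
    if S: "closed_subspace smul form S" "invariant_under G S" for S
  proof -
    have "g ` S \<subseteq> S" using S(2) gG by (simp add: invariant_under_def)
    have herm_sub: "hermitian_form_on smul f S" if "hermitian_form_on smul f UNIV" for f
      using that unfolding hermitian_form_on_def by blast
    have "hilbert_inner_on smul (\<lambda>x y. form (g x) y) S"
      unfolding hilbert_inner_on_def ip_dist_def
    proof (intro conjI ballI impI allI herm_sub[OF E.alt.hermitian], rule E.alt.ip_pos, assumption, elim conjE)
      fix \<sigma> :: "nat \<Rightarrow> 'a"
      assume \<sigma>: "range \<sigma> \<subseteq> S"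
        and cauchy: "\<forall>e>0. \<exists>M. \<forall>m\<ge>M. \<forall>n\<ge>M. E.alt.N (\<sigma> m - \<sigma> n) < e"
      have "\<exists>M. \<forall>m\<ge>M. \<forall>n\<ge>M. E.alt.N (\<sigma> m - \<sigma> n) < e" if "e > 0" for e
        using cauchy[rule_format, OF that] .
      then obtain x where x: "(\<lambda>n. E.alt.N (\<sigma> n - x)) \<longlonglongrightarrow> 0"
        by (rule E.alt.complete)
      \<comment> \<open>The limit exists in the whole space, and closedness of \<open>S\<close>
        keeps it in \<open>S\<close>.\<close>
      moreover have "x \<in> S"
        using S(1) \<sigma> x unfolding closed E.alt.seq_closed_def by blast
      ultimately show "\<exists>x\<in>S. (\<lambda>n. E.alt.N (\<sigma> n - x)) \<longlonglongrightarrow> 0" by blast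
    qed
    then have "fundamental_symmetry_on smul form S g"
      unfolding fundamental_symmetry_on_def
      using \<open>g ` S \<subseteq> S\<close> unitary(1)[OF gG] by (simp add: gg E.lin_iff)
    then show ?thesis
      using S(1) vs herm_sub[OF herm]
      unfolding regular_subspace_def krein_space_on_def closed_subspace_def by blast
  qed
  \<comment> \<open>Regular subspaces are closed by definition, and closed invariant ones were just
    shown regular, so both notions quantify over the same subspaces.\<close>
  then have "regularly_irreducible smul form G \<longleftrightarrow> topologically_irreducible smul form G"
    unfolding regularly_irreducible_def topologically_irreducible_def
    by (meson regular_subspace_def)
  then show ?thesis using op top by simp
qed

end
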